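(* Let $n,m\geq 1$ be integers with $n+m\geq 3$, set $d=m+n$, and let $\Theta=(\theta_{ij})$ be a real $n\times m$ matrix. Suppose that the set of integer solutions $(\vec x,\vec y)\in\mathbb Z^m\oplus\mathbb Z^n$ of the system $\Theta\vec x=\vec y$ is not a one-dimensional lattice (i.e. it is not a lattice of rank one). Then, with $\beta_1,\beta_2$ the first and second regular and $\alpha_1$ the first uniform Diophantine exponents of $\Theta$ (defined in the context): if $m=1$, then \[ \beta_2\geq\frac{\beta_1+\alpha_1}{1-\alpha_1}\,; \] if $m\geq 2$, then \[ \beta_2\geq\frac{\alpha_1-1}{2+\beta_1-\alpha_1}\quad\text{provided }\alpha_1\neq\infty, \] and (in all cases with $m\ge 2$) \[ \beta_2\geq\frac{1-\alpha_1^{-1}}{\beta_1^{-1}+\alpha_1^{-1}}\,. \]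
   Context: $|\cdot|$ denotes the sup-norm. Let $\pmb\ell_1,\ldots,\pmb\ell_m\in\mathbb R^d$ be the columns of the $d\times m$ matrix $\begin{pmatrix}E_m\\ \Theta\end{pmatrix}$, $E_m$ the $m\times m$ identity matrix. For a $k$-element subset $\sigma=\{i_1<\dots<i_k\}$ of $\{1,\ldots,m\}$ put $\vec L_\sigma=\pmb\ell_{i_1}\wedge\dots\wedge\pmb\ell_{i_k}$, and $\vec L_\varnothing=1$; let $\mathcal J_k$ be the set of $k$-element subsets of $\{1,\ldots,m\}$. Exterior powers of $\mathbb R^d$ carry the sup-norm of coordinates with respect to the standard basis $\vec e_{j_1}\wedge\dots\wedge\vec e_{j_q}$, and $\wedge^p(\mathbb Z^d)$ denotes the $p$-vectors with integer coordinates in that basis. For $1\le p\le d-1$ put $k_0=\max(0,m-p)$. The $p$-th regular (resp. uniform) Diophantine exponent $\beta_p$ (resp. $\alpha_p$) of $\Theta$ is the supremum of real $\gamma$ such that there are arbitrarily large $t$ for which (resp. such that for every sufficiently large $t$) the system $\max_{\sigma\in\mathcal J_k}|\vec L_\sigma\wedge\vec Z|\leq t^{1-(k-k_0)(1+\gamma)}$, $k=0,\ldots,m$, has a nonzero solution $\vec Z\in\wedge^p(\mathbb Z^d)$. (For $p=1$ these coincide with the classical exponents: $\beta_1$ (resp. $\alpha_1$) is the supremum of $\gamma$ such that for arbitrarily large $t$ (resp. all large $t$) the system $|\vec x|\le t$, $|\Theta\vec x-\vec y|\le t^{-\gamma}$ has a nonzero solution $(\vec x,\vec y)\in\mathbb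 Z^m\oplus\mathbb Z^n$.) Exponents may be $+\infty$; natural conventions such as $\infty^{-1}=0$ are used. *)

theory Defs
  imports Complex_Main "HOL-Library.Extended_Real" "Jordan_Normal_Form.Matrix"
begin

text \<open>
  The exterior algebra of \<open>\<real>\<^sup>d\<close> in coordinates. All indices are 0-based. A multivector \<open>X\<close> is
  given by its coordinates \<open>X I\<close> with respect to the basis vectors
  \<open>e\<^sub>I = e\<^bsub>i\<^sub>1\<^esub> \<and> \<dots> \<and> e\<^bsub>i\<^sub>q\<^esub>\<close>, where \<open>I = {i\<^sub>1 < \<dots> < i\<^sub>q} \<subseteq> {..<d}\<close>, and vanishes on all
  other sets.
\<close>

type_synonym multivector = "nat set \<Rightarrow> real"

definition k_subsets :: "nat \<Rightarrow> nat \<Rightarrow> nat set set" where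
  "k_subsets N k = {I. I \<subseteq> {..<N} \<and> card I = k}"

definition p_vectors :: "nat \<Rightarrow> nat \<Rightarrow> multivector set" where
  "p_vectors d p = {X. \<forall>I. I \<notin> k_subsets d p \<longrightarrow> X I = 0}"

definition integer_p_vectors :: "nat \<Rightarrow> nat \<Rightarrow> multivector set" where
  "integer_p_vectors d p = {X \<in> p_vectors d p. \<forall>I. X I \<in> \<int>}"

text \<open>
  For disjoint \<open>I\<close>, \<open>J\<close>, this is the sign of the permutation sorting the elements of \<open>I\<close>
  followed by those of \<open>J\<close>, so that \<open>e\<^sub>I \<and> e\<^sub>J = shuffle_sign I J e\<^bsub>I \<union> J\<^esub>\<close>.
\<close>

definition shuffle_sign :: "nat set \<Rightarrow> nat set \<Rightarrow> real" where
  "shuffle_sign I J = (- 1) ^ card {(i, j). i \<in> I \<and> j \<in> J \<and> j < i}"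

definition wedge :: "multivector \<Rightarrow> multivector \<Rightarrow> multivector" where
  "wedge X Y = (\<lambda>K. \<Sum>I\<in>Pow K. shuffle_sign I (K - I) * X I * Y (K - I))"

definition ext_one :: multivector where
  "ext_one = (\<lambda>I. if I = {} then 1 else 0)"

definition ext_of_vec :: "real vec \<Rightarrow> multivector" where
  "ext_of_vec v = (\<lambda>I. if \<exists>i<dim_vec v. I = {i} then v $ the_elem I else 0)"

text \<open>
  The maximum runs over all degrees; on a homogeneous multivector this is the sup-norm of the
  coordinates of that degree (and 0 if the degree exceeds \<open>d\<close>).
\<close>

definition ext_norm :: "nat \<Rightarrow> multivector \<Rightarrow> real" where
  "ext_norm d X = (MAX I\<in>Pow {..<d}. \<bar>X I\<bar>)"

definition ell :: "real mat \<Rightarrow> nat \<Rightarrow> real vec" where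
  "ell \<Theta> i = col (1\<^sub>m (dim_col \<Theta>) @\<^sub>r \<Theta>) i"

definition L_wedge :: "real mat \<Rightarrow> nat set \<Rightarrow> multivector" where
  "L_wedge \<Theta> \<sigma> = foldr (\<lambda>i. wedge (ext_of_vec (ell \<Theta> i))) (sorted_list_of_set \<sigma>) ext_one"

text \<open>Truncated subtraction on \<^typ>\<open>nat\<close> makes \<open>m - p\<close> equal to \<open>max(0, m - p)\<close>.\<close>

definition system_solvable :: "real mat \<Rightarrow> nat \<Rightarrow> real \<Rightarrow> real \<Rightarrow> bool" where
  "system_solvable \<Theta> p \<gamma> t \<longleftrightarrow>
    (let m = dim_col \<Theta>; d = m + dim_row \<Theta>; k0 = m - p in
      \<exists>Z \<in> integer_p_vectors d p. Z \<noteq> (\<lambda>_. 0) \<and>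
        (\<forall>k\<le>m. (MAX \<sigma>\<in>k_subsets m k. ext_norm d (wedge (L_wedge \<Theta> \<sigma>) Z))
                 \<le> t powr (1 - (real k - real k0) * (1 + \<gamma>))))"

definition regular_exponent :: "real mat \<Rightarrow> nat \<Rightarrow> ereal" where
  "regular_exponent \<Theta> p = (SUP \<gamma>\<in>{\<gamma>. \<exists>\<^sub>F t in at_top. system_solvable \<Theta> p \<gamma> t}. ereal \<gamma>)"

definition uniform_exponent :: "real mat \<Rightarrow> nat \<Rightarrow> ereal" where
  "uniform_exponent \<Theta> p = (SUP \<gamma>\<in>{\<gamma>. \<forall>\<^sub>F t in at_top. system_solvable \<Theta> p \<gamma> t}. ereal \<gamma>)"

definition integer_solutions :: "real mat \<Rightarrow> int vec set" where
  "integer_solutions \<Theta> =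
    {x @\<^sub>v y | x y. x \<in> carrier_vec (dim_col \<Theta>) \<and> y \<in> carrier_vec (dim_row \<Theta>) \<and>
                  \<Theta> *\<^sub>v map_vec real_of_int x = map_vec real_of_int y}"

definition rank_one_lattice :: "nat \<Rightarrow> int vec set \<Rightarrow> bool" where
  "rank_one_lattice d S \<longleftrightarrow>
    (\<exists>v \<in> carrier_vec d. v \<noteq> 0\<^sub>v d \<and> S = range (\<lambda>c :: int. c \<cdot>\<^sub>v v))"

end

theory Submission
  imports Defs "HOL-Analysis.Kronecker_Approximation_Theorem"
begin

text \<open>
  An integer vector \<open>z = (x, y)\<close> is written as \<open>\<Sum> x\<^sub>i \<ell>\<^sub>i\<close> plus a residual supported on the last
  \<open>n\<close> coordinates, where it equals \<open>y - \<Theta> x\<close>. Since \<open>L\<^sub>\<sigma> \<and> \<ell>\<^sub>i = 0\<close> for \<open>i \<in> \<sigma>\<close>, the first system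
  bounds \<open>x\<close> and \<open>\<Theta> x - y\<close>, and for the bivector \<open>Z = z \<and> z'\<close> the products \<open>L\<^sub>\<sigma> \<and> Z\<close> are
  controlled by \<open>|x| |x'|\<close>, by \<open>|x| |w'| + |x'| |w|\<close> and by \<open>|w| |w'|\<close> when \<open>\<sigma>\<close> has at most \<open>m - 2\<close>,
  exactly \<open>m - 1\<close> and exactly \<open>m\<close> elements; here \<open>w\<close>, \<open>w'\<close> are the residuals.

  If \<open>\<Theta> x = y\<close> has no nonzero integer solution, choose a primitive \<open>z'\<close> that realises \<open>\<beta>\<^sub>1\<close> and
  then, by the definition of \<open>\<alpha>\<^sub>1\<close>, a \<open>z\<close> with either \<open>|x| < |x'|\<close> or \<open>|w| < |w'|\<close>. Either way \<open>z\<close> is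
  not a multiple of \<open>z'\<close>, so \<open>Z \<noteq> 0\<close>. The first choice gives the bound for \<open>m = 1\<close> and the first
  bound for \<open>m \<ge> 2\<close>, the second choice the remaining one. Otherwise there are two independent
  solutions with zero residual, and their bivector shows \<open>\<beta>\<^sub>2 = \<infinity>\<close>.
\<close>

unbundle no vec_syntax

section \<open>The exterior algebra in coordinates\<close>

lemma abs_shuffle_sign [simp]: "\<bar>shuffle_sign I J\<bar> = 1"
  by (simp add: shuffle_sign_def power_abs)

lemma shuffle_sign_Ints: "shuffle_sign I J \<in> \<int>"
  by (simp add: shuffle_sign_def)

lemma shuffle_sign_empty [simp]: "shuffle_sign {} J = 1"
  by (simp add: shuffle_sign_def)

lemma shuffle_sign_singletons: "shuffle_sign {a} {b} = (if b < a then -1 else 1)"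
proof -
  have "{(i, j). i \<in> {a} \<and> j \<in> {b} \<and> j < i} = (if b < a then {(a, b)} else {})"
    by auto
  then show ?thesis by (simp add: shuffle_sign_def)
qed

lemma shuffle_sign_Un_left:
  assumes "finite I" "finite J" "finite L" "I \<inter> J = {}"
  shows "shuffle_sign (I \<union> J) L = shuffle_sign I L * shuffle_sign J L"
proof -
  let ?P = "\<lambda>I. {(i, j). i \<in> I \<and> j \<in> L \<and> j < i}"
  have "?P (I \<union> J) = ?P I \<union> ?P J" by auto
  moreover have "finite (?P A)" if "finite A" for A
    by (rule finite_subset[of _ "A \<times> L"]) (use that assms in auto)
  moreover have "?P I \<inter> ?P J = {}" using assms by auto
  ultimately have "card (?P (I \<union> J)) = card (?P I) + card (?P J)"
    using assms by (simp add: card_Un_disjoint)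
  then show ?thesis by (simp add: shuffle_sign_def power_add)
qed

lemma shuffle_sign_Un_right:
  assumes "finite I" "finite J" "finite L" "J \<inter> L = {}"
  shows "shuffle_sign I (J \<union> L) = shuffle_sign I J * shuffle_sign I L"
proof -
  let ?P = "\<lambda>J. {(i, j). i \<in> I \<and> j \<in> J \<and> j < i}"
  have "?P (J \<union> L) = ?P J \<union> ?P L" by auto
  moreover have "finite (?P A)" if "finite A" for A
    by (rule finite_subset[of _ "I \<times> A"]) (use that assms in auto)
  moreover have "?P J \<inter> ?P L = {}" using assms by auto
  ultimately have "card (?P (J \<union> L)) = card (?P J) + card (?P L)"
    using assms by (simp add: card_Un_disjoint)
  then show ?thesis by (simp add: shuffle_sign_def power_add)
qed

lemma wedge_infinite: "infinite K \<Longrightarrow> wedge X Y K = 0"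
  by (simp add: wedge_def)

lemma wedge_add_left: "wedge (\<lambda>I. X I + X' I) Y = (\<lambda>K. wedge X Y K + wedge X' Y K)"
  by (simp add: wedge_def algebra_simps sum.distrib)

lemma wedge_add_right: "wedge Y (\<lambda>I. X I + X' I) = (\<lambda>K. wedge Y X K + wedge Y X' K)"
  by (simp add: wedge_def algebra_simps sum.distrib)

lemma wedge_mult_left: "wedge (\<lambda>I. c * X I) Y = (\<lambda>K. c * wedge X Y K)"
  by (simp add: wedge_def sum_distrib_left mult_ac)

lemma wedge_mult_right: "wedge Y (\<lambda>I. c * X I) = (\<lambda>K. c * wedge Y X K)"
  by (simp add: wedge_def sum_distrib_left mult_ac)

lemma wedge_zero_left [simp]: "wedge (\<lambda>I. 0) Y = (\<lambda>K. 0)"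
  by (simp add: wedge_def)

lemma wedge_zero_right [simp]: "wedge Y (\<lambda>I. 0) = (\<lambda>K. 0)"
  by (simp add: wedge_def)

lemma wedge_sum_left: "wedge (\<lambda>I. \<Sum>i\<in>A. c i * X i I) Y = (\<lambda>K. \<Sum>i\<in>A. c i * wedge (X i) Y K)"
  by (induction A rule: infinite_finite_induct)
     (simp_all add: wedge_add_left wedge_mult_left)

lemma wedge_sum_right: "wedge Y (\<lambda>I. \<Sum>i\<in>A. c i * X i I) = (\<lambda>K. \<Sum>i\<in>A. c i * wedge Y (X i) K)"
  by (induction A rule: infinite_finite_induct)
     (simp_all add: wedge_add_right wedge_mult_right)

text \<open>Both sides run over the ordered splittings of \<open>K\<close> into three blocks.
  Splitting the signs over disjoint unions turns them into the same product, with one sign for each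
  pair of blocks.\<close>

lemma wedge_assoc: "wedge (wedge X Y) Z = wedge X (wedge Y Z)"
proof
  fix K
  show "wedge (wedge X Y) Z K = wedge X (wedge Y Z) K"
  proof (cases "finite K")
    case True
    have "wedge (wedge X Y) Z K = (\<Sum>(I, J)\<in>Sigma (Pow K) Pow.
      shuffle_sign I (K - I) * (shuffle_sign J (I - J) * X J * Y (I - J)) * Z (K - I))"
      using True unfolding wedge_def
      by (subst sum.Sigma[symmetric])
         (auto intro: finite_subset simp: sum_distrib_left sum_distrib_right)
    also have "\<dots> = (\<Sum>(J, M)\<in>Sigma (Pow K) (\<lambda>J. Pow (K - J)).
      shuffle_sign J (K - J) * X J * (shuffle_sign M (K - J - M) * Y M * Z (K - J - M)))"
    \<comment> \<open>The nested pair \<open>J \<subseteq> I\<close> corresponds to the disjoint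
      pair \<open>J\<close>, \<open>M = I - J\<close>; the third block is \<open>K - I\<close> in
      both descriptions.\<close>
    proof (rule sum.reindex_bij_witness[of _ "\<lambda>(J, M). (J \<union> M, J)" "\<lambda>(I, J). (J, I - J)"])
      fix a assume "a \<in> Sigma (Pow K) Pow"
      then obtain I J where a: "a = (I, J)" and IJ: "I \<subseteq> K" "J \<subseteq> I" by auto
      have fin: "finite I" "finite J" "finite (K - I)" "finite (I - J)"
        using True IJ by (auto intro: finite_subset)
      have "shuffle_sign I (K - I) = shuffle_sign (J \<union> (I - J)) (K - I)"
        using IJ by (auto intro: arg_cong2[where f = shuffle_sign])
      also have "\<dots> = shuffle_sign J (K - I) * shuffle_sign (I - J) (K - I)"
        using fin by (intro shuffle_sign_Un_left) auto
      finally have 1: "shuffle_sign I (K - I) = shuffle_sign J (K - I) * shuffle_sign (I - J) (K - I)" .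
      have "shuffle_sign J (K - J) = shuffle_sign J ((I - J) \<union> (K - I))"
        using IJ by (auto intro: arg_cong2[where f = shuffle_sign])
      also have "\<dots> = shuffle_sign J (I - J) * shuffle_sign J (K - I)"
        using fin by (intro shuffle_sign_Un_right) auto
      finally have 2: "shuffle_sign J (K - J) = shuffle_sign J (I - J) * shuffle_sign J (K - I)" .
      have "K - J - (I - J) = K - I" using IJ by auto
      with 1 2 show "(case case a of (I, J) \<Rightarrow> (J, I - J) of (J, M) \<Rightarrow>
          shuffle_sign J (K - J) * X J * (shuffle_sign M (K - J - M) * Y M * Z (K - J - M))) =
        (case a of (I, J) \<Rightarrow>
          shuffle_sign I (K - I) * (shuffle_sign J (I - J) * X J * Y (I - J)) * Z (K - I))"
        by (simp add: a)
    qed auto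
    also have "\<dots> = wedge X (wedge Y Z) K"
      using True unfolding wedge_def
      by (subst sum.Sigma[symmetric])
         (auto intro: finite_subset simp: sum_distrib_left sum_distrib_right)
    finally show ?thesis .
  qed (simp add: wedge_infinite)
qed

text \<open>A vector is a plain function here, read only below \<open>d\<close>, so that integer
  vectors, columns and residuals share one format without carrier conditions.\<close>

definition one_vector :: "nat \<Rightarrow> (nat \<Rightarrow> real) \<Rightarrow> multivector" where
  "one_vector d f = (\<lambda>I. if \<exists>i<d. I = {i} then f (the_elem I) else 0)"

lemma one_vector_singleton [simp]: "one_vector d f {i} = (if i < d then f i else 0)"
  by (auto simp: one_vector_def)

lemma one_vector_eq_0: "(\<And>i. i < d \<Longrightarrow> I \<noteq> {i}) \<Longrightarrow> one_vector d f I = 0"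
  by (auto simp: one_vector_def)

lemma one_vector_nonzeroE:
  assumes "one_vector d f I \<noteq> 0"
  obtains i where "i < d" "I = {i}"
  using assms by (auto simp: one_vector_def split: if_splits)

lemma ext_of_vec_eq_one_vector: "ext_of_vec v = one_vector (dim_vec v) (\<lambda>i. v $ i)"
  by (simp add: ext_of_vec_def one_vector_def)

text \<open>Complementation inside \<open>K\<close> exchanges the two factors. Only splittings into
  two distinct singletons contribute, and exchanging these toggles their single possible
  inversion.\<close>

lemma wedge_one_vector_anticommute:
  "wedge (one_vector d f) (one_vector d g) = (\<lambda>K. - 1 * wedge (one_vector d g) (one_vector d f) K)"
proof
  fix K
  have "(\<Sum>I\<in>Pow K. shuffle_sign I (K - I) * one_vector d f I * one_vector d g (K - I)) =
    (\<Sum>I\<in>Pow K. - (shuffle_sign I (K - I) * one_vector d g I * one_vector d f (K - I)))"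
  proof (rule sum.reindex_bij_witness[of _ "\<lambda>I. K - I" "\<lambda>I. K - I"])
    fix I assume "I \<in> Pow K"
    then have KI: "K - (K - I) = I" by auto
    show "- (shuffle_sign (K - I) (K - (K - I)) * one_vector d g (K - I) * one_vector d f (K - (K - I))) =
        shuffle_sign I (K - I) * one_vector d f I * one_vector d g (K - I)"
    proof (cases "one_vector d f I = 0 \<or> one_vector d g (K - I) = 0")
      case True
      then show ?thesis by (auto simp: KI)
    next
      case False
      then obtain a b where ab: "I = {a}" "K - I = {b}"
        by (metis one_vector_nonzeroE)
      then have "a \<noteq> b" by auto
      then have "shuffle_sign (K - I) I = - shuffle_sign I (K - I)"
        unfolding ab(2) unfolding ab(1) by (auto simp: shuffle_sign_singletons)
      then show ?thesis by (simp add: KI)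
    qed
  qed auto
  then show "wedge (one_vector d f) (one_vector d g) K = - 1 * wedge (one_vector d g) (one_vector d f) K"
    by (simp add: wedge_def sum_negf)
qed

lemma wedge_one_vector_swap:
  "wedge (one_vector d f) (wedge (one_vector d g) Y) = (\<lambda>K. - 1 * wedge (one_vector d g) (wedge (one_vector d f) Y) K)"
  by (subst (1 2) wedge_assoc[symmetric], subst wedge_one_vector_anticommute, subst wedge_mult_left) simp

lemma wedge_one_vector_twice: "wedge (one_vector d f) (wedge (one_vector d f) Y) = (\<lambda>_. 0)"
  using wedge_one_vector_swap[of d f f Y] by (auto simp: fun_eq_iff)

lemma wedge_ext_one_left:
  assumes "finite K" shows "wedge ext_one Y K = Y K"
proof -
  have "wedge ext_one Y K = (\<Sum>I\<in>{{}}. shuffle_sign I (K - I) * ext_one I * Y (K - I))"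
    unfolding wedge_def using assms
    by (intro sum.mono_neutral_right) (auto simp: ext_one_def)
  then show ?thesis by (simp add: ext_one_def)
qed

text \<open>\<open>ext_one\<close> acts as a unit at finite index sets. At an infinite
  \<open>K\<close> the sum over \<open>Pow K\<close> is 0 by default, and so is the product on the
  right.\<close>

lemma wedge_ext_one_wedge: "wedge ext_one (wedge X Y) = wedge X Y"
proof
  show "wedge ext_one (wedge X Y) K = wedge X Y K" for K
    by (cases "finite K") (simp_all add: wedge_ext_one_left wedge_infinite)
qed

text \<open>Every factor that the vector passes contributes one sign. This serves to bring a
  repeated column next to its first copy.\<close>

lemma foldr_wedge_commute:
  fixes e :: "nat \<Rightarrow> nat \<Rightarrow> real" and js d
  defines "R \<equiv> \<lambda>js. foldr (\<lambda>i. wedge (one_vector d (e i))) js ext_one"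
  shows "wedge (R js) (wedge (one_vector d f) Y) =
    (\<lambda>K. (- 1) ^ length js * wedge (one_vector d f) (wedge (R js) Y) K)"
proof (induction js)
  case Nil
  have "wedge (one_vector d f) (wedge ext_one Y) = wedge (one_vector d f) Y"
  proof
    show "wedge (one_vector d f) (wedge ext_one Y) K = wedge (one_vector d f) Y K" for K
    proof (cases "finite K")
      case True
      then show ?thesis
        by (auto simp: wedge_def[of "one_vector d f"] intro!: sum.cong wedge_ext_one_left)
    qed (simp add: wedge_infinite)
  qed
  then show ?case by (simp add: R_def wedge_ext_one_wedge)
next
  case (Cons a js)
  have "wedge (R (a # js)) (wedge (one_vector d f) Y) =
      wedge (one_vector d (e a)) (wedge (R js) (wedge (one_vector d f) Y))"
    by (simp add: R_def wedge_assoc)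
  also have "\<dots> = (\<lambda>K. (- 1) ^ length (a # js) *
      wedge (one_vector d f) (wedge (one_vector d (e a)) (wedge (R js) Y)) K)"
    unfolding Cons.IH wedge_mult_right by (subst wedge_one_vector_swap) simp
  also have "wedge (one_vector d (e a)) (wedge (R js) Y) = wedge (R (a # js)) Y"
    by (simp add: R_def wedge_assoc)
  finally show ?case .
qed

text \<open>A repeated factor kills the product. If \<open>i\<close> occurs in the tail, induction
  applies; otherwise it is the head, and the second copy is moved past the tail until the two are
  adjacent.\<close>

lemma foldr_wedge_annihilates:
  fixes e :: "nat \<Rightarrow> nat \<Rightarrow> real"
  assumes "i \<in> set js"
  shows "wedge (foldr (\<lambda>i. wedge (one_vector d (e i))) js ext_one) (wedge (one_vector d (e i)) Y) = (\<lambda>_. 0)"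
  using assms
proof (induction js)
  case (Cons a js)
  show ?case
  proof (cases "i \<in> set js")
    case True
    then show ?thesis using Cons.IH by (simp add: wedge_assoc)
  next
    case False
    with Cons.prems have "a = i" by simp
    then show ?thesis
      by (simp add: wedge_assoc foldr_wedge_commute wedge_mult_right wedge_one_vector_twice)
  qed
qed simp

text \<open>A coordinate of a product has at most \<open>2 ^ d\<close> summands; so crude a constant
  does not affect the exponents.\<close>

lemma abs_wedge_le:
  assumes X: "\<And>K. K \<subseteq> {..<d} \<Longrightarrow> \<bar>X K\<bar> \<le> A" and Y: "\<And>K. K \<subseteq> {..<d} \<Longrightarrow> \<bar>Y K\<bar> \<le> B"
    and K: "K \<subseteq> {..<d}"
  shows "\<bar>wedge X Y K\<bar> \<le> 2 ^ d * A * B"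
proof -
  have A: "0 \<le> A" and B: "0 \<le> B"
    using X[of "{}"] Y[of "{}"] by auto
  have "\<bar>wedge X Y K\<bar> \<le> (\<Sum>I\<in>Pow K. \<bar>shuffle_sign I (K - I) * X I * Y (K - I)\<bar>)"
    unfolding wedge_def by (rule sum_abs)
  also have "\<dots> \<le> (\<Sum>I\<in>Pow K. A * B)"
  proof (rule sum_mono)
    fix I assume "I \<in> Pow K"
    with K have "\<bar>X I\<bar> \<le> A" "\<bar>Y (K - I)\<bar> \<le> B"
      using X Y by (auto intro: X Y)
    then show "\<bar>shuffle_sign I (K - I) * X I * Y (K - I)\<bar> \<le> A * B"
      by (simp add: abs_mult mult_mono A)
  qed
  also have "\<dots> = 2 ^ card K * (A * B)"
    using K by (simp add: card_Pow finite_subset)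
  also have "\<dots> \<le> 2 ^ d * (A * B)"
    using card_mono[OF _ K] A B by (intro mult_right_mono power_increasing) auto
  finally show ?thesis by (simp add: mult_ac)
qed

lemma wedge_Ints:
  assumes "\<And>I. X I \<in> \<int>" "\<And>I. Y I \<in> \<int>"
  shows "wedge X Y K \<in> \<int>"
  unfolding wedge_def using assms by (intro Ints_sum Ints_mult shuffle_sign_Ints) auto

lemma wedge_one_vector_p_vectors: "wedge (one_vector d f) (one_vector d g) \<in> p_vectors d 2"
proof -
  have "wedge (one_vector d f) (one_vector d g) K = 0" if K: "K \<notin> k_subsets d 2" for K
    unfolding wedge_def
  proof (rule sum.neutral, rule ballI)
    fix I assume I: "I \<in> Pow K"
    show "shuffle_sign I (K - I) * one_vector d f I * one_vector d g (K - I) = 0"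
    proof (rule ccontr)
      assume "\<not> ?thesis"
      then obtain a b where ab: "a < d" "b < d" "I = {a}" "K - I = {b}"
        by (auto elim!: one_vector_nonzeroE)
      with I have "K = {a, b}" "a \<noteq> b" by auto
      with ab have "K \<in> k_subsets d 2" by (auto simp: k_subsets_def)
      with K show False ..
    qed
  qed
  then show ?thesis by (simp add: p_vectors_def)
qed

lemma one_vector_p_vectors: "one_vector d f \<in> p_vectors d 1"
  by (auto simp: p_vectors_def k_subsets_def one_vector_def)

lemma p_vectors_1_eq_one_vector:
  assumes "Z \<in> p_vectors d 1"
  shows "Z = one_vector d (\<lambda>i. Z {i})"
proof
  fix I
  show "Z I = one_vector d (\<lambda>i. Z {i}) I"
  proof (cases "\<exists>i<d. I = {i}")
    case False
    then have "I \<notin> k_subsets d 1" by (auto simp: k_subsets_def card_1_singleton_iff)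
    with assms False show ?thesis by (simp add: p_vectors_def one_vector_eq_0)
  qed auto
qed

lemma wedge_one_vector_pair:
  assumes "i < j" "j < d"
  shows "wedge (one_vector d f) (one_vector d g) {i, j} = f i * g j - f j * g i"
proof -
  have "wedge (one_vector d f) (one_vector d g) {i, j} = (\<Sum>I\<in>{{i}, {j}}.
      shuffle_sign I ({i, j} - I) * one_vector d f I * one_vector d g ({i, j} - I))"
    unfolding wedge_def using assms
    by (intro sum.mono_neutral_right) (auto simp: one_vector_def)
  also have "\<dots> = f i * g j - f j * g i"
    using assms by (simp add: shuffle_sign_singletons insert_Diff_if)
  finally show ?thesis .
qed

lemma abs_le_ext_norm: "I \<subseteq> {..<d} \<Longrightarrow> \<bar>X I\<bar> \<le> ext_norm d X"
  unfolding ext_norm_def by (rule Max_ge) auto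

lemma ext_norm_le: "(\<And>I. I \<subseteq> {..<d} \<Longrightarrow> \<bar>X I\<bar> \<le> B) \<Longrightarrow> ext_norm d X \<le> B"
  unfolding ext_norm_def by (rule Max.boundedI) auto

lemma finite_k_subsets [simp]: "finite (k_subsets N k)"
  by (rule finite_subset[of _ "Pow {..<N}"]) (auto simp: k_subsets_def)

lemma k_subsets_nonempty: "k \<le> N \<Longrightarrow> k_subsets N k \<noteq> {}"
  using obtain_subset_with_card_n[of k "{..<N}"] by (auto simp: k_subsets_def)

section \<open>Systems of linear forms\<close>

lemma wedge_one_vector_ext_one: "wedge (one_vector d f) ext_one = one_vector d f"
proof
  fix K
  show "wedge (one_vector d f) ext_one K = one_vector d f K"
  proof (cases "finite K")
    case True
    have "wedge (one_vector d f) ext_one K =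
        (\<Sum>I\<in>{K}. shuffle_sign I (K - I) * one_vector d f I * ext_one (K - I))"
      unfolding wedge_def using True
      by (intro sum.mono_neutral_right) (auto simp: ext_one_def)
    then show ?thesis by (auto simp: ext_one_def shuffle_sign_def)
  next
    case False
    then have "one_vector d f K = 0" by (intro one_vector_eq_0) auto
    with False show ?thesis by (simp add: wedge_infinite)
  qed
qed

lemma abs_one_vector_le:
  assumes "\<And>i. i < d \<Longrightarrow> \<bar>f i\<bar> \<le> B" "0 \<le> B"
  shows "\<bar>one_vector d f K\<bar> \<le> B"
  using assms by (auto simp: one_vector_def)

section \<open>Columns, residuals and the size of an integer vector\<close>

locale linear_system =
  fixes m n :: nat and \<Theta> :: "real mat"
  assumes m_pos: "m \<ge> 1" and n_pos: "n \<ge> 1" and \<Theta>_carrier: "\<Theta> \<in> carrier_mat n m"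
begin

definition column :: "nat \<Rightarrow> nat \<Rightarrow> real" where
  "column i j = (if j < m then (if i = j then 1 else 0) else \<Theta> $$ (j - m, i))"

abbreviation column_vector :: "nat \<Rightarrow> multivector" where
  "column_vector i \<equiv> one_vector (m + n) (column i)"

definition residual :: "(nat \<Rightarrow> real) \<Rightarrow> nat \<Rightarrow> real" where
  "residual z j = (if j < m then 0 else z j - (\<Sum>i<m. \<Theta> $$ (j - m, i) * z i))"

abbreviation residual_vector :: "(nat \<Rightarrow> real) \<Rightarrow> multivector" where
  "residual_vector z \<equiv> one_vector (m + n) (residual z)"

text \<open>
  Sums rather than maxima: the exponents are insensitive to constant factors.
\<close>

definition head :: "(nat \<Rightarrow> real) \<Rightarrow> real" where
  "head z = (\<Sum>i<m. \<bar>z i\<bar>)"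

definition defect :: "(nat \<Rightarrow> real) \<Rightarrow> real" where
  "defect z = (\<Sum>j\<in>{m..<m+n}. \<bar>residual z j\<bar>)"

definition nontrivial :: "(nat \<Rightarrow> int) \<Rightarrow> bool" where
  "nontrivial z \<longleftrightarrow> (\<exists>i<m+n. z i \<noteq> 0)"

lemma head_nonneg [simp]: "0 \<le> head z"
  by (simp add: head_def sum_nonneg)

lemma defect_nonneg [simp]: "0 \<le> defect z"
  by (simp add: defect_def sum_nonneg)

lemma dims [simp]: "dim_col \<Theta> = m" "dim_row \<Theta> = n"
  using \<Theta>_carrier by auto

lemma ext_of_vec_ell:
  assumes "i < m" shows "ext_of_vec (ell \<Theta> i) = column_vector i"
proof -
  have "ell \<Theta> i $ j = column i j" if "j < m + n" for j
    using assms that \<Theta>_carrier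
    by (auto simp: ell_def column_def append_rows_def)
  moreover have "dim_vec (ell \<Theta> i) = m + n"
    using \<Theta>_carrier by (auto simp: ell_def append_rows_def)
  ultimately show ?thesis
    by (auto simp: ext_of_vec_eq_one_vector one_vector_def fun_eq_iff)
qed

lemma L_wedge_eq_foldr:
  assumes "\<sigma> \<subseteq> {..<m}"
  shows "L_wedge \<Theta> \<sigma> = foldr (\<lambda>i. wedge (column_vector i)) (sorted_list_of_set \<sigma>) ext_one"
  unfolding L_wedge_def using assms finite_subset[OF assms]
  by (intro foldr_cong) (auto simp: ext_of_vec_ell)

lemma L_wedge_annihilates:
  assumes "\<sigma> \<subseteq> {..<m}" "i \<in> \<sigma>"
  shows "wedge (L_wedge \<Theta> \<sigma>) (wedge (column_vector i) Y) = (\<lambda>_. 0)"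
  using assms finite_subset[OF assms(1)]
  by (simp add: L_wedge_eq_foldr foldr_wedge_annihilates)

lemma one_vector_decomposition:
  "one_vector (m + n) z = (\<lambda>I. (\<Sum>i<m. z i * column_vector i I) + residual_vector z I)"
proof
  fix I
  show "one_vector (m + n) z I = (\<Sum>i<m. z i * column_vector i I) + residual_vector z I"
  proof (cases "\<exists>j<m+n. I = {j}")
    case True
    then obtain j where j: "j < m + n" "I = {j}" by blast
    show ?thesis
    proof (cases "j < m")
      case True
      then have "(\<Sum>i<m. z i * column i j) = (\<Sum>i<m. if i = j then z i else 0)"
        by (intro sum.cong) (auto simp: column_def)
      with True j show ?thesis by (simp add: residual_def)
    next
      case False
      then have "(\<Sum>i<m. z i * column i j) = (\<Sum>i<m. \<Theta> $$ (j - m, i) * z i)"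
        by (intro sum.cong) (auto simp: column_def)
      with False j show ?thesis by (simp add: residual_def)
    qed
  next
    case False
    then show ?thesis by (simp add: one_vector_eq_0)
  qed
qed

text \<open>Columns with index in \<sigma> repeat a factor of \<open>L_wedge\<close> and drop out of
  the decomposition. \<open>Y\<close> stays arbitrary: \<open>ext_one\<close> yields the case of a
  single vector, a second vector that of a bivector.\<close>

lemma wedge_L_wedge_expand:
  assumes "\<sigma> \<subseteq> {..<m}"
  shows "wedge (L_wedge \<Theta> \<sigma>) (wedge (one_vector (m + n) z) Y) =
    (\<lambda>K. (\<Sum>i\<in>{..<m} - \<sigma>. z i * wedge (L_wedge \<Theta> \<sigma>) (wedge (column_vector i) Y) K) +
      wedge (L_wedge \<Theta> \<sigma>) (wedge (residual_vector z) Y) K)"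
proof -
  have "(\<Sum>i<m. z i * wedge (L_wedge \<Theta> \<sigma>) (wedge (column_vector i) Y) K) =
      (\<Sum>i\<in>{..<m} - \<sigma>. z i * wedge (L_wedge \<Theta> \<sigma>) (wedge (column_vector i) Y) K)" for K
    using assms by (intro sum.mono_neutral_right) (auto simp: L_wedge_annihilates)
  then show ?thesis
    by (subst one_vector_decomposition)
       (simp add: wedge_add_left wedge_add_right wedge_sum_left wedge_sum_right)
qed

text \<open>No index lies outside the full \<sigma>, so the expansion replaces the first factor by
  its residual. Anticommuting brings the second factor to the front, where the same applies.\<close>

lemma wedge_L_wedge_full_pair:
  "wedge (L_wedge \<Theta> {..<m}) (wedge (one_vector (m + n) z) (one_vector (m + n) z')) =
    wedge (L_wedge \<Theta> {..<m}) (wedge (residual_vector z) (residual_vector z'))"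
  (is "wedge ?L _ = _")
proof -
  have "wedge ?L (wedge (one_vector (m + n) z) (one_vector (m + n) z')) =
      wedge ?L (wedge (residual_vector z) (one_vector (m + n) z'))"
    by (subst wedge_L_wedge_expand) auto
  also have "\<dots> = (\<lambda>K. - 1 * wedge ?L (wedge (one_vector (m + n) z') (residual_vector z)) K)"
    by (subst wedge_one_vector_anticommute, subst wedge_mult_right) simp
  also have "\<dots> = (\<lambda>K. - 1 * wedge ?L (wedge (residual_vector z') (residual_vector z)) K)"
    by (subst wedge_L_wedge_expand) auto
  also have "\<dots> = wedge ?L (wedge (residual_vector z) (residual_vector z'))"
    by (subst (2) wedge_one_vector_anticommute, subst wedge_mult_right) simp
  finally show ?thesis .
qed

text \<open>Only column \<open>j\<close> survives. The term with \<open>z j * z' j\<close> contains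
  the square of that column and vanishes, so every remaining term carries at least one
  residual.\<close>

lemma wedge_L_wedge_almost_full_pair:
  assumes "j < m"
  defines "L \<equiv> L_wedge \<Theta> ({..<m} - {j})"
  shows "wedge L (wedge (one_vector (m + n) z) (one_vector (m + n) z')) =
    (\<lambda>K. z j * wedge L (wedge (column_vector j) (residual_vector z')) K
      - z' j * wedge L (wedge (column_vector j) (residual_vector z)) K
      + wedge L (wedge (residual_vector z) (residual_vector z')) K)"
proof -
  have *: "wedge L (wedge (one_vector (m + n) u) Y) =
      (\<lambda>K. u j * wedge L (wedge (column_vector j) Y) K + wedge L (wedge (residual_vector u) Y) K)" for u Y
  proof -
    have "{..<m} - ({..<m} - {j}) = {j}" using assms by auto
    then show ?thesis unfolding L_def by (subst wedge_L_wedge_expand) auto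
  qed
  have neg: "wedge L (wedge (one_vector (m + n) f) (one_vector (m + n) g)) =
      (\<lambda>K. - 1 * wedge L (wedge (one_vector (m + n) g) (one_vector (m + n) f)) K)" for f g
    by (subst wedge_one_vector_anticommute, subst wedge_mult_right) simp
  have "wedge (column_vector j) (column_vector j) = (\<lambda>_. 0)"
    using wedge_one_vector_anticommute[of "m + n" "column j" "column j"] by (auto simp: fun_eq_iff)
  then have "wedge L (wedge (column_vector j) (one_vector (m + n) z')) =
      wedge L (wedge (column_vector j) (residual_vector z'))"
    by (subst neg, subst *, subst (2) neg) simp
  moreover have "wedge L (wedge (residual_vector z) (one_vector (m + n) z')) =
      (\<lambda>K. - (z' j * wedge L (wedge (column_vector j) (residual_vector z)) K)
        + wedge L (wedge (residual_vector z) (residual_vector z')) K)"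
    by (subst neg, subst *, subst (2) neg) simp
  ultimately show ?thesis by (subst *) (simp add: algebra_simps)
qed

text \<open>The first \<open>m\<close> coordinates of the columns form the identity matrix, so
  within \<open>{..<m}\<close> the product behaves like a product of basis vectors. Absolute values
  spare the bookkeeping of its sign.\<close>

lemma abs_foldr_wedge_column:
  assumes "distinct js" "set js \<subseteq> {..<m}" "I \<subseteq> {..<m}"
  shows "\<bar>foldr (\<lambda>i. wedge (column_vector i)) js ext_one I\<bar> = (if I = set js then 1 else 0)"
  using assms
proof (induction js arbitrary: I)
  case Nil
  then show ?case by (auto simp: ext_one_def)
next
  case (Cons a js)
  let ?R = "foldr (\<lambda>i. wedge (column_vector i)) js ext_one"
  have fin: "finite I" using Cons.prems finite_subset by blast
  have zero: "column_vector a J = 0" if "J \<subseteq> I" "J \<noteq> {a}" for J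
    using that Cons.prems by (auto simp: one_vector_def column_def)
  show ?case
  proof (cases "a \<in> I")
    case True
    have "wedge (column_vector a) ?R I =
        (\<Sum>J\<in>{{a}}. shuffle_sign J (I - J) * column_vector a J * ?R (I - J))"
      unfolding wedge_def using fin True zero
      by (intro sum.mono_neutral_right) auto
    also have "\<dots> = shuffle_sign {a} (I - {a}) * ?R (I - {a})"
      using Cons.prems by (simp add: column_def)
    finally have "\<bar>wedge (column_vector a) ?R I\<bar> = \<bar>?R (I - {a})\<bar>"
      by (simp add: abs_mult)
    also have "\<dots> = (if I - {a} = set js then 1 else 0)"
      using Cons.prems by (subst Cons.IH) auto
    also have "I - {a} = set js \<longleftrightarrow> I = set (a # js)"
      using True Cons.prems by auto
    finally show ?thesis by simp
  next
    case False
    then have "wedge (column_vector a) ?R I = 0"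
      unfolding wedge_def using zero by (intro sum.neutral) auto
    with False show ?thesis by auto
  qed
qed

lemma abs_L_wedge:
  assumes "\<sigma> \<subseteq> {..<m}" "I \<subseteq> {..<m}"
  shows "\<bar>L_wedge \<Theta> \<sigma> I\<bar> = (if I = \<sigma> then 1 else 0)"
  using assms finite_subset[OF assms(1)]
  by (simp add: L_wedge_eq_foldr abs_foldr_wedge_column)

lemma wedge_L_wedge_full_single:
  "wedge (L_wedge \<Theta> {..<m}) (one_vector (m + n) z) = wedge (L_wedge \<Theta> {..<m}) (residual_vector z)"
  using wedge_L_wedge_expand[of "{..<m}" z ext_one] by (simp add: wedge_one_vector_ext_one)

text \<open>Inside \<open>{..<m}\<close> the only nonzero coordinate of \<open>L_wedge\<close> sits
  at the set missing \<open>j\<close>, which leaves \<open>{j}\<close> for the vector. This recovers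
  the entries of the head from the system.\<close>

lemma abs_wedge_L_wedge_head:
  assumes "j < m"
  shows "\<bar>wedge (L_wedge \<Theta> ({..<m} - {j})) (one_vector (m + n) z) {..<m}\<bar> = \<bar>z j\<bar>"
proof -
  let ?s = "{..<m} - {j}"
  have eq: "{..<m} - ?s = {j}" using assms by auto
  have "L_wedge \<Theta> ?s I = 0" if "I \<subseteq> {..<m}" "I \<noteq> ?s" for I
    using abs_L_wedge[of ?s I] that by auto
  then have "wedge (L_wedge \<Theta> ?s) (one_vector (m + n) z) {..<m} =
      (\<Sum>I\<in>{?s}. shuffle_sign I ({..<m} - I) * L_wedge \<Theta> ?s I * one_vector (m + n) z ({..<m} - I))"
    unfolding wedge_def by (intro sum.mono_neutral_right) auto
  then show ?thesis
    using assms abs_L_wedge[of ?s ?s] by (simp add: eq abs_mult)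
qed

text \<open>Once \<open>z\<close> is replaced by its residual, which vanishes at the first
  \<open>m\<close> coordinates, only \<open>{j}\<close> can be left for the second factor. This is
  how the system controls the defect.\<close>

lemma abs_wedge_L_wedge_residual:
  assumes "m \<le> j" "j < m + n"
  shows "\<bar>wedge (L_wedge \<Theta> {..<m}) (one_vector (m + n) z) (insert j {..<m})\<bar> = \<bar>residual z j\<bar>"
proof -
  define K where "K = insert j {..<m}"
  have K: "K - {..<m} = {j}" "{..<m} \<subseteq> K" "finite K"
    using assms by (auto simp: K_def)
  have zero: "residual_vector z (K - I) = 0" if I: "I \<subseteq> K" "I \<noteq> {..<m}" for I
  proof (rule ccontr)
    assume "residual_vector z (K - I) \<noteq> 0"
    then obtain i where i: "K - I = {i}" and "residual_vector z {i} \<noteq> 0"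
      by (metis one_vector_nonzeroE)
    then have "\<not> i < m" by (auto simp: residual_def)
    moreover from i have "i \<in> K" by blast
    ultimately have "i = j" using K by auto
    with i I(1) have "I = K - {j}" by auto
    also have "\<dots> = {..<m}" using assms by (auto simp: K_def)
    finally show False using I by simp
  qed
  have "wedge (L_wedge \<Theta> {..<m}) (residual_vector z) K =
      (\<Sum>I\<in>{{..<m}}. shuffle_sign I (K - I) * L_wedge \<Theta> {..<m} I * residual_vector z (K - I))"
    unfolding wedge_def using K zero by (intro sum.mono_neutral_right) auto
  also have "\<bar>\<dots>\<bar> = \<bar>residual z j\<bar>"
    using assms K abs_L_wedge[of "{..<m}" "{..<m}"] by (simp add: abs_mult)
  finally have "\<bar>wedge (L_wedge \<Theta> {..<m}) (one_vector (m + n) z) K\<bar> = \<bar>residual z j\<bar>"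
    by (subst wedge_L_wedge_full_single)
  then show ?thesis by (simp only: K_def)
qed

text \<open>For \<open>k \<le> m\<close> the set \<open>k_subsets m k\<close> is nonempty, so a
  bound on the \<open>MAX\<close> is a bound on each member. The nested maxima dissolve into one
  condition per \<sigma> and coordinate, with \<open>k\<close> recovered as
  \<open>card \<sigma>\<close>.\<close>

lemma system_solvable_iff:
  "system_solvable \<Theta> p \<gamma> t \<longleftrightarrow> (\<exists>Z\<in>integer_p_vectors (m + n) p. Z \<noteq> (\<lambda>_. 0) \<and>
    (\<forall>\<sigma> I. \<sigma> \<subseteq> {..<m} \<longrightarrow> I \<subseteq> {..<m + n} \<longrightarrow> \<bar>wedge (L_wedge \<Theta> \<sigma>) Z I\<bar>
      \<le> t powr (1 - (real (card \<sigma>) - real (m - p)) * (1 + \<gamma>))))"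
proof -
  have norm: "ext_norm (m + n) X \<le> B \<longleftrightarrow> (\<forall>I\<subseteq>{..<m + n}. \<bar>X I\<bar> \<le> B)" for X B
    by (meson abs_le_ext_norm ext_norm_le order_trans)
  have "(\<forall>k\<le>m. (MAX \<sigma>\<in>k_subsets m k. ext_norm (m + n) (wedge (L_wedge \<Theta> \<sigma>) Z)) \<le> f k) \<longleftrightarrow>
      (\<forall>\<sigma> I. \<sigma> \<subseteq> {..<m} \<longrightarrow> I \<subseteq> {..<m + n} \<longrightarrow> \<bar>wedge (L_wedge \<Theta> \<sigma>) Z I\<bar> \<le> f (card \<sigma>))"
    (is "?l \<longleftrightarrow> ?r") for Z and f :: "nat \<Rightarrow> real"
  proof -
    have "?l \<longleftrightarrow> (\<forall>k\<le>m. \<forall>\<sigma>\<in>k_subsets m k. ext_norm (m + n) (wedge (L_wedge \<Theta> \<sigma>) Z) \<le> f k)"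
      by (simp add: k_subsets_nonempty)
    also have "\<dots> \<longleftrightarrow> (\<forall>\<sigma>\<subseteq>{..<m}. ext_norm (m + n) (wedge (L_wedge \<Theta> \<sigma>) Z) \<le> f (card \<sigma>))"
    proof -
      have "card \<sigma> \<le> m" if "\<sigma> \<subseteq> {..<m}" for \<sigma>
        using card_mono[OF _ that] by simp
      then show ?thesis by (auto simp: k_subsets_def)
    qed
    finally show ?thesis unfolding norm by blast
  qed
  then show ?thesis by (simp add: system_solvable_def Let_def)
qed

text \<open>For \<open>p = 1\<close> one has \<open>k0 = m - 1\<close>, so the sizes
  \<open>m - 1\<close> and \<open>m\<close> carry the exponents 1 and \<open>- \<gamma>\<close>.
  Suitable coordinates of these products are the entries of the head and of the residual; summing
  them gives the factors \<open>m\<close> and \<open>n\<close>.\<close>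

lemma solvable_imp_approximation:
  fixes t :: real
  assumes "system_solvable \<Theta> 1 \<gamma> t" "t > 0"
  obtains z where "nontrivial z" "head z \<le> real m * t" "defect z \<le> real n * t powr (- \<gamma>)"
proof -
  obtain Z where Z: "Z \<in> integer_p_vectors (m + n) 1" "Z \<noteq> (\<lambda>_. 0)"
    and le: "\<And>\<sigma> I. \<sigma> \<subseteq> {..<m} \<Longrightarrow> I \<subseteq> {..<m + n} \<Longrightarrow> \<bar>wedge (L_wedge \<Theta> \<sigma>) Z I\<bar>
      \<le> t powr (1 - (real (card \<sigma>) - real (m - 1)) * (1 + \<gamma>))"
    using assms unfolding system_solvable_iff by blast
  define z where "z i = \<lfloor>Z {i}\<rfloor>" for i
  have z: "real_of_int (z i) = Z {i}" for i
    using Z by (auto simp: z_def integer_p_vectors_def elim!: Ints_cases)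
  have Zz: "Z = one_vector (m + n) z"
    using p_vectors_1_eq_one_vector[of Z "m + n"] Z by (simp add: z integer_p_vectors_def)
  have nz: "nontrivial z"
  proof (rule ccontr)
    assume "\<not> ?thesis"
    then have "Z = (\<lambda>_. 0)" unfolding Zz by (auto simp: one_vector_def fun_eq_iff nontrivial_def)
    with Z show False by simp
  qed
  have "\<bar>real_of_int (z j)\<bar> \<le> t" if "j < m" for j
    using le[of "{..<m} - {j}" "{..<m}"] that assms
    by (auto simp: Zz abs_wedge_L_wedge_head)
  then have "head z \<le> real m * t"
    unfolding head_def using sum_mono[of "{..<m}" "\<lambda>i. \<bar>real_of_int (z i)\<bar>" "\<lambda>_. t"] by auto
  moreover have "\<bar>residual z j\<bar> \<le> t powr (- \<gamma>)" if "j \<in> {m..<m+n}" for j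
    using le[of "{..<m}" "insert j {..<m}"] that m_pos
    by (auto simp: Zz abs_wedge_L_wedge_residual of_nat_diff)
  then have "defect z \<le> real n * t powr (- \<gamma>)"
    unfolding defect_def
    using sum_mono[of "{m..<m+n}" "\<lambda>j. \<bar>residual z j\<bar>" "\<lambda>_. t powr (- \<gamma>)"] by auto
  ultimately show thesis using nz that by blast
qed

end

section \<open>Primitive integer vectors\<close>

definition primitive_on :: "nat \<Rightarrow> (nat \<Rightarrow> int) \<Rightarrow> bool" where
  "primitive_on d p \<longleftrightarrow>
    (\<forall>u. (\<forall>i<d. \<forall>j<d. u i * p j = u j * p i) \<longrightarrow> (\<exists>c. \<forall>i<d. u i = c * p i))"

text \<open>Primitivity is defined by the property used later, that proportional integer vectors are
  integer multiples; here it is derived from gcd 1. Since \<open>p i\<close> divides every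
  \<open>u i * p j\<close>, it divides their gcd, which is \<open>u i\<close> up to sign.\<close>

lemma primitive_onI_Gcd:
  assumes "Gcd (p ` {..<d}) = 1" "i < d" "p i \<noteq> 0"
  shows "primitive_on d p"
  unfolding primitive_on_def
proof (intro allI impI)
  fix u :: "nat \<Rightarrow> int" assume u: "\<forall>i<d. \<forall>j<d. u i * p j = u j * p i"
  have "p i dvd Gcd ((*) (u i) ` (p ` {..<d}))"
    by (rule Gcd_greatest) (use u assms in auto)
  then have "p i dvd u i" by (simp add: Gcd_mult assms)
  then obtain c where c: "u i = p i * c" by (auto simp: dvd_def)
  have "u j = c * p j" if "j < d" for j
  proof -
    have "p i * u j = p i * (c * p j)"
      using u assms that c by (metis mult.assoc mult.commute)
    then show ?thesis using assms by simp
  qed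
  then show "\<exists>c. \<forall>i<d. u i = c * p i" by blast
qed

lemma primitive_on_exists:
  fixes z :: "nat \<Rightarrow> int"
  assumes "i < d" "z i \<noteq> 0"
  obtains p g where "primitive_on d p" "g \<noteq> 0" "\<And>i. i < d \<Longrightarrow> z i = g * p i"
proof -
  define g where "g = Gcd (z ` {..<d})"
  define p where "p i = z i div g" for i
  have g: "g \<noteq> 0"
    using assms by (auto simp: g_def Gcd_0_iff)
  have z: "z i = g * p i" if "i < d" for i
    using that by (simp add: p_def g_def Gcd_dvd)
  have "(*) g ` p ` {..<d} = z ` {..<d}"
    using z by (auto simp: image_image)
  then have "normalize (g * Gcd (p ` {..<d})) = g"
    by (metis Gcd_mult g_def)
  moreover have "g \<ge> 0" "Gcd (p ` {..<d}) \<ge> 0" by (simp_all add: g_def)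
  ultimately have "Gcd (p ` {..<d}) = 1" using g by simp
  then have "primitive_on d p"
    using assms g z by (intro primitive_onI_Gcd[of p d i]) auto
  with g z show thesis using that by blast
qed

lemma primitive_on_wedge_eq_0:
  fixes u p :: "nat \<Rightarrow> int"
  assumes "primitive_on d p" "wedge (one_vector d u) (one_vector d p) = (\<lambda>_. 0)"
  shows "\<exists>c. \<forall>i<d. u i = c * p i"
proof -
  have *: "u i * p j = u j * p i" if "i < j" "j < d" for i j
  proof -
    have "real_of_int (u i) * p j - u j * p i = 0"
      using wedge_one_vector_pair[OF that, of u p] assms(2) by simp
    then have "real_of_int (u i * p j) = real_of_int (u j * p i)" by simp
    then show ?thesis by (simp only: of_int_eq_iff)
  qed
  have "u i * p j = u j * p i" if "i < d" "j < d" for i j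
    using *[of i j] *[of j i] that by (cases i j rule: linorder_cases) auto
  with assms(1) show ?thesis unfolding primitive_on_def by blast
qed

section \<open>Uniform bounds for products with \<open>L_wedge\<close>\<close>

context linear_system
begin

lemma coordinate_bound:
  obtains M where "1 \<le> M" "\<And>\<sigma> I. \<sigma> \<subseteq> {..<m} \<Longrightarrow> I \<subseteq> {..<m + n} \<Longrightarrow> \<bar>L_wedge \<Theta> \<sigma> I\<bar> \<le> M"
    "\<And>i I. i < m \<Longrightarrow> I \<subseteq> {..<m + n} \<Longrightarrow> \<bar>column_vector i I\<bar> \<le> M"
proof -
  \<comment> \<open>Only finitely many coordinates occur; inserting 1 makes the maximum at least
    1.\<close>
  define S where "S = insert 1 ((\<lambda>(\<sigma>, I). \<bar>L_wedge \<Theta> \<sigma> I\<bar>) ` (Pow {..<m} \<times> Pow {..<m + n})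
    \<union> (\<lambda>(i, I). \<bar>column_vector i I\<bar>) ` ({..<m} \<times> Pow {..<m + n}))"
  have fin: "finite S" by (auto simp: S_def)
  show thesis
  proof (rule that[of "Max S"])
    show "1 \<le> Max S" by (rule Max_ge[OF fin]) (simp add: S_def)
    show "\<bar>L_wedge \<Theta> \<sigma> I\<bar> \<le> Max S" if "\<sigma> \<subseteq> {..<m}" "I \<subseteq> {..<m + n}" for \<sigma> I
      by (rule Max_ge[OF fin]) (use that in \<open>auto simp: S_def\<close>)
    show "\<bar>column_vector i I\<bar> \<le> Max S" if "i < m" "I \<subseteq> {..<m + n}" for i I
      by (rule Max_ge[OF fin]) (use that in \<open>auto simp: S_def\<close>)
  qed
qed

lemma abs_residual_vector_le: "\<bar>residual_vector z I\<bar> \<le> defect z"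
proof (rule abs_one_vector_le)
  fix j assume "j < m + n"
  show "\<bar>residual z j\<bar> \<le> defect z"
  proof (cases "j < m")
    case True
    then show ?thesis by (simp add: residual_def)
  next
    case False
    with \<open>j < m + n\<close> show ?thesis
      unfolding defect_def by (intro member_le_sum[of _ _ "\<lambda>j. \<bar>residual z j\<bar>"]) auto
  qed
qed simp

lemma abs_le_head: "j < m \<Longrightarrow> \<bar>z j\<bar> \<le> head z"
  unfolding head_def by (rule member_le_sum[of j "{..<m}" "\<lambda>j. \<bar>z j\<bar>"]) auto

lemma abs_one_vector_le_head_defect:
  assumes "1 \<le> M" "\<And>i. i < m \<Longrightarrow> \<bar>column_vector i I\<bar> \<le> M"
  shows "\<bar>one_vector (m + n) z I\<bar> \<le> M * (head z + defect z)"
proof -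
  have "\<bar>one_vector (m + n) z I\<bar> \<le> (\<Sum>i<m. \<bar>z i * column_vector i I\<bar>) + \<bar>residual_vector z I\<bar>"
    unfolding one_vector_decomposition[of z]
    by (rule order_trans[OF abs_triangle_ineq]) (intro add_right_mono sum_abs)
  also have "\<dots> \<le> (\<Sum>i<m. \<bar>z i\<bar> * M) + defect z"
    using assms by (intro add_mono sum_mono abs_residual_vector_le) (auto simp: abs_mult intro: mult_left_mono)
  also have "\<dots> = M * head z + 1 * defect z"
    by (simp add: head_def sum_distrib_left mult_ac)
  also have "\<dots> \<le> M * head z + M * defect z"
    using assms by (intro add_left_mono mult_right_mono) auto
  finally show ?thesis by (simp add: algebra_simps)
qed

text \<open>The gain for \<sigma> of size \<open>m - 1\<close> or \<open>m\<close> comes from the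
  expansions into residuals; for smaller \<sigma> the trivial estimate is enough.\<close>

lemma wedge_L_wedge_bounds:
  obtains C where "1 \<le> C"
    "\<And>z \<sigma> I. \<sigma> \<subseteq> {..<m} \<Longrightarrow> I \<subseteq> {..<m + n} \<Longrightarrow>
      \<bar>wedge (L_wedge \<Theta> \<sigma>) (one_vector (m + n) z) I\<bar> \<le> C * (head z + defect z)"
    "\<And>z I. I \<subseteq> {..<m + n} \<Longrightarrow>
      \<bar>wedge (L_wedge \<Theta> {..<m}) (one_vector (m + n) z) I\<bar> \<le> C * defect z"
    "\<And>z z' \<sigma> I. \<sigma> \<subseteq> {..<m} \<Longrightarrow> I \<subseteq> {..<m + n} \<Longrightarrow>
      \<bar>wedge (L_wedge \<Theta> \<sigma>) (wedge (one_vector (m + n) z) (one_vector (m + n) z')) I\<bar>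
        \<le> C * ((head z + defect z) * (head z' + defect z'))"
    "\<And>z z' \<sigma> I. \<sigma> \<subseteq> {..<m} \<Longrightarrow> Suc (card \<sigma>) = m \<Longrightarrow> I \<subseteq> {..<m + n} \<Longrightarrow>
      \<bar>wedge (L_wedge \<Theta> \<sigma>) (wedge (one_vector (m + n) z) (one_vector (m + n) z')) I\<bar>
        \<le> C * (head z * defect z' + head z' * defect z + defect z * defect z')"
    "\<And>z z' I. I \<subseteq> {..<m + n} \<Longrightarrow>
      \<bar>wedge (L_wedge \<Theta> {..<m}) (wedge (one_vector (m + n) z) (one_vector (m + n) z')) I\<bar>
        \<le> C * (defect z * defect z')"
proof -
  obtain M where M: "1 \<le> M"
    and L: "\<And>\<sigma> I. \<sigma> \<subseteq> {..<m} \<Longrightarrow> I \<subseteq> {..<m + n} \<Longrightarrow> \<bar>L_wedge \<Theta> \<sigma> I\<bar> \<le> M"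
    and col: "\<And>i I. i < m \<Longrightarrow> I \<subseteq> {..<m + n} \<Longrightarrow> \<bar>column_vector i I\<bar> \<le> M"
    using coordinate_bound by metis
  define D :: real where "D = 2 ^ (m + n)"
  \<comment> \<open>Each of the at most two products costs a factor \<open>D\<close> for its number
    of summands; \<open>L_wedge\<close> and each of the two vectors cost at most a factor
    \<open>M\<close>. Estimates with fewer such factors are dominated, since \<open>D\<close> and
    \<open>M\<close> are at least 1.\<close>
  define C where "C = D * D * M * M * M"
  have D: "1 \<le> D" by (simp add: D_def)
  have vec: "\<bar>one_vector (m + n) z I\<bar> \<le> M * (head z + defect z)" if "I \<subseteq> {..<m + n}" for z I
    using abs_one_vector_le_head_defect M col that by blast
  have w1: "\<bar>wedge (L_wedge \<Theta> \<sigma>) X I\<bar> \<le> D * M * B"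
    if "\<sigma> \<subseteq> {..<m}" "I \<subseteq> {..<m + n}" "\<And>K. K \<subseteq> {..<m + n} \<Longrightarrow> \<bar>X K\<bar> \<le> B" for \<sigma> X B I
    unfolding D_def using that by (intro abs_wedge_le L) auto
  have w2: "\<bar>wedge (L_wedge \<Theta> \<sigma>) (wedge X Y) I\<bar> \<le> D * M * (D * A * B)"
    if "\<sigma> \<subseteq> {..<m}" "I \<subseteq> {..<m + n}" "\<And>K. K \<subseteq> {..<m + n} \<Longrightarrow> \<bar>X K\<bar> \<le> A"
      "\<And>K. K \<subseteq> {..<m + n} \<Longrightarrow> \<bar>Y K\<bar> \<le> B" for \<sigma> X Y A B I
    using that by (intro w1) (auto simp: D_def intro!: abs_wedge_le)
  have one_le: "1 \<le> D * M" "1 \<le> D * M * M" "1 \<le> M * M"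
    using D M by (simp_all add: mult_ge1_I)
  have C1: "D * M * M * x \<le> C * x" "D * D * M * x \<le> C * x" "D * M * x \<le> C * x" "D * D * M * M * x \<le> C * x"
    if "0 \<le> x" for x
  proof -
    have "D * M * M * 1 \<le> D * M * M * (D * M)" "D * D * M * 1 \<le> D * D * M * (M * M)"
      "D * M * 1 \<le> D * M * (D * M * M)" "D * D * M * M * 1 \<le> D * D * M * M * M"
      using one_le M D by (auto intro!: mult_left_mono)
    then have "D * M * M \<le> C" "D * D * M \<le> C" "D * M \<le> C" "D * D * M * M \<le> C"
      unfolding C_def by (simp_all only: mult_ac mult_1_right)
    then show "D * M * M * x \<le> C * x" "D * D * M * x \<le> C * x" "D * M * x \<le> C * x" "D * D * M * M * x \<le> C * x"
      using that by (auto intro!: mult_right_mono)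
  qed
  have C_ge: "1 \<le> C" unfolding C_def using D M by (simp add: mult_ge1_I)
  show thesis
  proof (rule that[OF C_ge])
    fix z \<sigma> I assume "\<sigma> \<subseteq> {..<m}" "I \<subseteq> {..<m + n}"
    then have "\<bar>wedge (L_wedge \<Theta> \<sigma>) (one_vector (m + n) z) I\<bar> \<le> D * M * (M * (head z + defect z))"
      by (intro w1 vec)
    also have "\<dots> \<le> C * (head z + defect z)" using C1(1) by (simp add: mult.assoc)
    finally show "\<bar>wedge (L_wedge \<Theta> \<sigma>) (one_vector (m + n) z) I\<bar> \<le> C * (head z + defect z)" .
  next
    fix z I assume "I \<subseteq> {..<m + n}"
    then have "\<bar>wedge (L_wedge \<Theta> {..<m}) (residual_vector z) I\<bar> \<le> D * M * defect z"
      by (intro w1 abs_residual_vector_le) auto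
    also have "\<dots> \<le> C * defect z" using C1(3) by simp
    finally show "\<bar>wedge (L_wedge \<Theta> {..<m}) (one_vector (m + n) z) I\<bar> \<le> C * defect z"
      by (subst wedge_L_wedge_full_single)
  next
    fix z z' \<sigma> I assume "\<sigma> \<subseteq> {..<m}" "I \<subseteq> {..<m + n}"
    then have "\<bar>wedge (L_wedge \<Theta> \<sigma>) (wedge (one_vector (m + n) z) (one_vector (m + n) z')) I\<bar>
        \<le> D * M * (D * (M * (head z + defect z)) * (M * (head z' + defect z')))"
      by (intro w2 vec)
    also have "\<dots> = C * ((head z + defect z) * (head z' + defect z'))"
      by (simp add: C_def)
    finally show "\<bar>wedge (L_wedge \<Theta> \<sigma>) (wedge (one_vector (m + n) z) (one_vector (m + n) z')) I\<bar>
        \<le> C * ((head z + defect z) * (head z' + defect z'))" .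
  next
    fix z z' \<sigma> I assume \<sigma>: "\<sigma> \<subseteq> {..<m}" "Suc (card \<sigma>) = m" and I: "I \<subseteq> {..<m + n}"
    have "card ({..<m} - \<sigma>) = 1"
      using \<sigma> finite_subset[OF \<sigma>(1)] by (subst card_Diff_subset) auto
    then obtain j where j: "{..<m} - \<sigma> = {j}" by (auto simp: card_1_singleton_iff)
    with \<sigma> have \<sigma>_eq: "\<sigma> = {..<m} - {j}" and "j < m" by auto
    let ?W = "\<lambda>X Y. \<bar>wedge (L_wedge \<Theta> \<sigma>) (wedge X Y) I\<bar>"
    have c: "?W (column_vector j) (residual_vector u) \<le> C * defect u" for u
    proof -
      have "?W (column_vector j) (residual_vector u) \<le> D * M * (D * M * defect u)"
        using \<sigma> I \<open>j < m\<close> by (intro w2 col abs_residual_vector_le) auto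
      also have "\<dots> \<le> C * defect u" using C1(4)[of "defect u"] by (simp add: mult_ac)
      finally show ?thesis .
    qed
    have r: "?W (residual_vector z) (residual_vector z') \<le> C * (defect z * defect z')"
    proof -
      have "?W (residual_vector z) (residual_vector z') \<le> D * M * (D * defect z * defect z')"
        using \<sigma> I by (intro w2 abs_residual_vector_le) auto
      also have "\<dots> \<le> C * (defect z * defect z')" using C1(2)[of "defect z * defect z'"] by (simp add: mult_ac)
      finally show ?thesis .
    qed
    have eq: "wedge (L_wedge \<Theta> \<sigma>) (wedge (one_vector (m + n) z) (one_vector (m + n) z')) I =
        z j * wedge (L_wedge \<Theta> \<sigma>) (wedge (column_vector j) (residual_vector z')) I
        - z' j * wedge (L_wedge \<Theta> \<sigma>) (wedge (column_vector j) (residual_vector z)) I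
        + wedge (L_wedge \<Theta> \<sigma>) (wedge (residual_vector z) (residual_vector z')) I"
      using fun_cong[OF wedge_L_wedge_almost_full_pair[OF \<open>j < m\<close>]] unfolding \<sigma>_eq .
    have "?W (one_vector (m + n) z) (one_vector (m + n) z') \<le>
        \<bar>z j\<bar> * ?W (column_vector j) (residual_vector z') + \<bar>z' j\<bar> * ?W (column_vector j) (residual_vector z)
        + ?W (residual_vector z) (residual_vector z')"
      unfolding eq abs_mult[symmetric]
      by linarith
    also have "\<dots> \<le> head z * (C * defect z') + head z' * (C * defect z) + C * (defect z * defect z')"
      using \<open>j < m\<close> by (intro add_mono mult_mono c r abs_le_head) auto
    finally show "?W (one_vector (m + n) z) (one_vector (m + n) z') \<le>
        C * (head z * defect z' + head z' * defect z + defect z * defect z')"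
      by (simp add: algebra_simps)
  next
    fix z z' I assume "I \<subseteq> {..<m + n}"
    then have "\<bar>wedge (L_wedge \<Theta> {..<m}) (wedge (residual_vector z) (residual_vector z')) I\<bar>
        \<le> D * M * (D * defect z * defect z')"
      by (intro w2 abs_residual_vector_le) auto
    also have "\<dots> \<le> C * (defect z * defect z')" using C1(2)[of "defect z * defect z'"] by (simp add: mult_ac)
    finally show "\<bar>wedge (L_wedge \<Theta> {..<m}) (wedge (one_vector (m + n) z) (one_vector (m + n) z')) I\<bar>
        \<le> C * (defect z * defect z')"
      by (subst wedge_L_wedge_full_pair)
  qed
qed

lemma head_scale: "(\<And>i. i < m + n \<Longrightarrow> z i = c * p i) \<Longrightarrow> head z = \<bar>c\<bar> * head p"
  by (simp add: head_def abs_mult sum_distrib_left)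

lemma defect_scale:
  assumes "\<And>i. i < m + n \<Longrightarrow> z i = c * p i"
  shows "defect z = \<bar>c\<bar> * defect p"
proof -
  have "residual z j = c * residual p j" if "j < m + n" for j
    using assms that by (simp add: residual_def algebra_simps sum_distrib_left)
  then show ?thesis by (simp add: defect_def abs_mult sum_distrib_left)
qed

text \<open>Finitely many integer vectors, up to irrelevant coordinates, have head at most
  \<open>B\<close> and defect at most 1, and each nonzero one has positive defect; hence a positive
  minimum. It later forces the head to grow as the defect tends to 0.\<close>

lemma defect_bounded_below:
  fixes B :: real
  assumes trivial: "\<And>z :: nat \<Rightarrow> int. defect z = 0 \<Longrightarrow> \<not> nontrivial z"
  obtains \<delta> where "0 < \<delta>"
    "\<And>z. nontrivial z \<Longrightarrow> head z \<le> B \<Longrightarrow> \<delta> \<le> defect z"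
proof -
  obtain M where M: "1 \<le> M" "\<And>i I. i < m \<Longrightarrow> I \<subseteq> {..<m + n} \<Longrightarrow> \<bar>column_vector i I\<bar> \<le> M"
    using coordinate_bound by metis
  define N where "N = \<lceil>M * (B + 1)\<rceil>"
  define F where "F = {z. \<forall>i. (i \<in> {..<m + n} \<longrightarrow> z i \<in> {- N..N}) \<and> (i \<notin> {..<m + n} \<longrightarrow> z i = 0)}"
  \<comment> \<open>The inserted 1 covers the vectors with defect above 1.\<close>
  define S where "S = insert 1 ((\<lambda>z. defect (\<lambda>i. real_of_int (z i))) ` {z \<in> F. nontrivial z})"
  have "finite F" unfolding F_def by (rule finite_set_of_finite_funs) auto
  then have fin: "finite S" by (simp add: S_def)
  have pos: "0 < s" if "s \<in> S" for s
  proof -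
    have "0 < defect (\<lambda>i. real_of_int (z i))" if "nontrivial z" for z
      using trivial[of z] that defect_nonneg[of "\<lambda>i. real_of_int (z i)"] by linarith
    with that show ?thesis by (auto simp: S_def)
  qed
  show thesis
  proof (rule that)
    show "0 < Min S" using pos fin by (subst Min_gr_iff) (auto simp: S_def)
  next
    fix z assume z: "nontrivial z" "head (\<lambda>i. real_of_int (z i)) \<le> B"
    show "Min S \<le> defect z"
    proof (cases "defect z \<le> 1")
      case False
      have "Min S \<le> 1" using fin by (intro Min_le) (auto simp: S_def)
      with False show ?thesis by simp
    next
      case True
      \<comment> \<open>Members of \<open>F\<close> vanish from \<open>m + n\<close> on, so
        \<open>z\<close> is cut off there; this leaves the defect unchanged.\<close>
      define z' where "z' i = (if i < m + n then z i else 0)" for i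
      have "z i \<in> {- N..N}" if "i < m + n" for i
      proof -
        have "\<bar>real_of_int (z i)\<bar> = \<bar>one_vector (m + n) z {i}\<bar>" using that by simp
        also have "\<dots> \<le> M * (head z + defect z)"
          using that by (intro abs_one_vector_le_head_defect M) auto
        also have "\<dots> \<le> M * (B + 1)" using True z M by (intro mult_left_mono) auto
        finally have "\<bar>z i\<bar> \<le> N" unfolding N_def by linarith
        then show ?thesis by auto
      qed
      then have "z' \<in> F" by (auto simp: F_def z'_def)
      moreover have "nontrivial z'" using z by (auto simp: z'_def nontrivial_def)
      ultimately have "defect z' \<in> S" unfolding S_def by blast
      then have "Min S \<le> defect z'" using fin by simp
      also have "defect z' = defect z"
        using defect_scale[of z' 1 z] by (simp add: z'_def)
      finally show ?thesis .
    qed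
  qed
qed

end

section \<open>Bivectors and the second exponent\<close>

text \<open>A strict gap between exponents absorbs every constant.\<close>

lemma eventually_const_powr_le:
  fixes a b C :: real
  assumes "a < b"
  shows "\<forall>\<^sub>F x in at_top. C * x powr a \<le> x powr b"
proof -
  have "filterlim (\<lambda>x::real. x powr (b - a)) at_top at_top"
    using assms by (intro real_powr_at_top) simp
  then have "\<forall>\<^sub>F x in at_top. C \<le> x powr (b - a)"
    by (simp add: filterlim_at_top)
  then show ?thesis
  proof eventually_elim
    case (elim x)
    then have "C * x powr a \<le> x powr (b - a) * x powr a"
      by (intro mult_right_mono) auto
    then show ?case by (simp flip: powr_add)
  qed
qed

context linear_system
begin

abbreviation bivector :: "(nat \<Rightarrow> int) \<Rightarrow> (nat \<Rightarrow> int) \<Rightarrow> multivector" where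
  "bivector z z' \<equiv> wedge (one_vector (m + n) z) (one_vector (m + n) z')"

text \<open>Three values suffice because the bivector estimates distinguish only the sizes
  \<open>m\<close>, \<open>m - 1\<close> and smaller. For \<open>m = 1\<close> the size 0 already
  falls under \<open>Suc k = m\<close>.\<close>

definition size_exponent :: "real \<Rightarrow> real \<Rightarrow> real \<Rightarrow> nat \<Rightarrow> real" where
  "size_exponent a0 a1 a2 k = (if k = m then a2 else if Suc k = m then a1 else a0)"

text \<open>
  The scale \<open>H\<close> is intrinsic to the bivector; the parameter of the system will be \<open>t = H\<^sup>s\<close> with a
  suitable \<open>s\<close>.
\<close>

definition small_bivectors :: "real \<Rightarrow> real \<Rightarrow> real \<Rightarrow> bool" where
  "small_bivectors a0 a1 a2 \<longleftrightarrow> (\<exists>C. \<forall>B. \<exists>H\<ge>B. \<exists>Z\<in>integer_p_vectors (m + n) 2. Z \<noteq> (\<lambda>_. 0) \<and>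
    (\<forall>\<sigma> I. \<sigma> \<subseteq> {..<m} \<longrightarrow> I \<subseteq> {..<m + n} \<longrightarrow>
      \<bar>wedge (L_wedge \<Theta> \<sigma>) Z I\<bar> \<le> C * H powr size_exponent a0 a1 a2 (card \<sigma>)))"

lemma one_vector_integer: "one_vector d (\<lambda>i. real_of_int (z i)) I \<in> \<int>"
  by (auto simp: one_vector_def)

lemma bivector_integer: "bivector z z' \<in> integer_p_vectors (m + n) 2"
  using wedge_Ints one_vector_integer wedge_one_vector_p_vectors
  by (simp add: integer_p_vectors_def)

lemma card_le_m: "\<sigma> \<subseteq> {..<m} \<Longrightarrow> card \<sigma> \<le> m"
  using card_mono[of "{..<m}" \<sigma>] by simp

lemma card_eq_m: "\<sigma> \<subseteq> {..<m} \<Longrightarrow> card \<sigma> = m \<Longrightarrow> \<sigma> = {..<m}"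
  using card_subset_eq[of "{..<m}" \<sigma>] by simp

lemma small_bivectorsI:
  assumes "\<And>B. \<exists>H\<ge>B. \<exists>z z' :: nat \<Rightarrow> int. bivector z z' \<noteq> (\<lambda>_. 0) \<and>
    (head z + defect z) * (head z' + defect z') \<le> K * H powr a0 \<and>
    head z * defect z' + head z' * defect z + defect z * defect z' \<le> K * H powr a1 \<and>
    defect z * defect z' \<le> K * H powr a2"
  shows "small_bivectors a0 a1 a2"
proof -
  obtain C where C: "1 \<le> C"
    and C0: "\<And>z z' \<sigma> I. \<sigma> \<subseteq> {..<m} \<Longrightarrow> I \<subseteq> {..<m + n} \<Longrightarrow>
      \<bar>wedge (L_wedge \<Theta> \<sigma>) (wedge (one_vector (m + n) z) (one_vector (m + n) z')) I\<bar>
        \<le> C * ((head z + defect z) * (head z' + defect z'))"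
    and C1: "\<And>z z' \<sigma> I. \<sigma> \<subseteq> {..<m} \<Longrightarrow> Suc (card \<sigma>) = m \<Longrightarrow> I \<subseteq> {..<m + n} \<Longrightarrow>
      \<bar>wedge (L_wedge \<Theta> \<sigma>) (wedge (one_vector (m + n) z) (one_vector (m + n) z')) I\<bar>
        \<le> C * (head z * defect z' + head z' * defect z + defect z * defect z')"
    and C2: "\<And>z z' I. I \<subseteq> {..<m + n} \<Longrightarrow>
      \<bar>wedge (L_wedge \<Theta> {..<m}) (wedge (one_vector (m + n) z) (one_vector (m + n) z')) I\<bar>
        \<le> C * (defect z * defect z')"
    using wedge_L_wedge_bounds by metis
  have "\<exists>H\<ge>B. \<exists>Z\<in>integer_p_vectors (m + n) 2. Z \<noteq> (\<lambda>_. 0) \<and>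
    (\<forall>\<sigma> I. \<sigma> \<subseteq> {..<m} \<longrightarrow> I \<subseteq> {..<m + n} \<longrightarrow>
      \<bar>wedge (L_wedge \<Theta> \<sigma>) Z I\<bar> \<le> C * K * H powr size_exponent a0 a1 a2 (card \<sigma>))" for B
  proof -
    obtain H and z z' :: "nat \<Rightarrow> int" where H: "H \<ge> B" and nz: "bivector z z' \<noteq> (\<lambda>_. 0)"
      and K0: "(head z + defect z) * (head z' + defect z') \<le> K * H powr a0"
      and K1: "head z * defect z' + head z' * defect z + defect z * defect z' \<le> K * H powr a1"
      and K2: "defect z * defect z' \<le> K * H powr a2"
      using assms[of B] by blast
    have scale: "C * x \<le> C * K * H powr a" if "x \<le> K * H powr a" for x a
      using mult_left_mono[OF that, of C] C by (simp add: mult.assoc)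
    have "\<bar>wedge (L_wedge \<Theta> \<sigma>) (bivector z z') I\<bar> \<le> C * K * H powr size_exponent a0 a1 a2 (card \<sigma>)"
      if \<sigma>: "\<sigma> \<subseteq> {..<m}" and I: "I \<subseteq> {..<m + n}" for \<sigma> I
    proof -
      consider "\<sigma> = {..<m}" "card \<sigma> = m" | "Suc (card \<sigma>) = m" | "card \<sigma> \<noteq> m" "Suc (card \<sigma>) \<noteq> m"
        using card_eq_m \<sigma> by blast
      then show ?thesis
      proof cases
        case 1
        then show ?thesis using order_trans[OF C2 scale[OF K2]] \<sigma> I by (simp add: size_exponent_def)
      next
        case 2
        then have "card \<sigma> \<noteq> m" by simp
        then show ?thesis using order_trans[OF C1 scale[OF K1]] \<sigma> I 2 by (simp add: size_exponent_def)
      next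
        case 3
        then show ?thesis using order_trans[OF C0 scale[OF K0]] \<sigma> I by (simp add: size_exponent_def)
      qed
    qed
    with H nz bivector_integer show ?thesis by blast
  qed
  then show ?thesis unfolding small_bivectors_def by blast
qed

text \<open>With \<open>t = H powr s\<close>, the strict inequalities absorb \<open>C\<close> for
  all of the finitely many sizes at once when \<open>H\<close> is large; \<open>s > 0\<close> lets
  \<open>t\<close> exceed any bound.\<close>

lemma small_bivectors_imp_regular_exponent_ge:
  assumes small: "small_bivectors a0 a1 a2" and "s > 0"
    and lt: "\<And>k. k \<le> m \<Longrightarrow> size_exponent a0 a1 a2 k < s * (1 - (real k - real (m - 2)) * (1 + \<gamma>))"
  shows "ereal \<gamma> \<le> regular_exponent \<Theta> 2"
proof -
  let ?e = "\<lambda>k. 1 - (real k - real (m - 2)) * (1 + \<gamma>)"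
  obtain C where C: "\<And>B. \<exists>H\<ge>B. \<exists>Z\<in>integer_p_vectors (m + n) 2. Z \<noteq> (\<lambda>_. 0) \<and>
    (\<forall>\<sigma> I. \<sigma> \<subseteq> {..<m} \<longrightarrow> I \<subseteq> {..<m + n} \<longrightarrow>
      \<bar>wedge (L_wedge \<Theta> \<sigma>) Z I\<bar> \<le> C * H powr size_exponent a0 a1 a2 (card \<sigma>))"
    using small unfolding small_bivectors_def by blast
  have "\<exists>t>B. system_solvable \<Theta> 2 \<gamma> t" for B
  proof -
    have "\<forall>\<^sub>F H in at_top. \<forall>k\<in>{..m}. C * H powr size_exponent a0 a1 a2 k \<le> H powr (s * ?e k)"
      using lt by (intro eventually_ball_finite ballI eventually_const_powr_le) auto
    moreover have "\<forall>\<^sub>F H in at_top. B < H powr s"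
      using real_powr_at_top[OF \<open>s > 0\<close>] by (simp add: filterlim_at_top_dense)
    ultimately have "\<forall>\<^sub>F H in at_top.
        (\<forall>k\<in>{..m}. C * H powr size_exponent a0 a1 a2 k \<le> H powr (s * ?e k)) \<and> B < H powr s"
      by (rule eventually_conj)
    then obtain H0 where H0: "\<And>H. H \<ge> H0 \<Longrightarrow>
        (\<forall>k\<in>{..m}. C * H powr size_exponent a0 a1 a2 k \<le> H powr (s * ?e k)) \<and> B < H powr s"
      unfolding eventually_at_top_linorder by blast
    obtain H Z where H: "H \<ge> H0" and Z: "Z\<in>integer_p_vectors (m + n) 2" "Z \<noteq> (\<lambda>_. 0)"
      and le: "\<And>\<sigma> I. \<sigma> \<subseteq> {..<m} \<Longrightarrow> I \<subseteq> {..<m + n} \<Longrightarrow>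
        \<bar>wedge (L_wedge \<Theta> \<sigma>) Z I\<bar> \<le> C * H powr size_exponent a0 a1 a2 (card \<sigma>)"
      using C[of H0] by blast
    have "\<bar>wedge (L_wedge \<Theta> \<sigma>) Z I\<bar> \<le> (H powr s) powr ?e (card \<sigma>)"
      if "\<sigma> \<subseteq> {..<m}" "I \<subseteq> {..<m + n}" for \<sigma> I
    proof -
      have "C * H powr size_exponent a0 a1 a2 (card \<sigma>) \<le> H powr (s * ?e (card \<sigma>))"
        using H0[OF H] card_le_m that by blast
      with le[OF that] show ?thesis unfolding powr_powr by linarith
    qed
    with Z have "system_solvable \<Theta> 2 \<gamma> (H powr s)"
      unfolding system_solvable_iff by blast
    with H0[OF H] show ?thesis by blast
  qed
  then have "\<exists>\<^sub>F t in at_top. system_solvable \<Theta> 2 \<gamma> t"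
    by (auto simp: frequently_def eventually_at_top_dense)
  then show ?thesis
    unfolding regular_exponent_def by (intro SUP_upper) simp
qed

text \<open>Here \<open>k0 = m - 2\<close>, so \<open>k - k0\<close> is 2, 1 or at most 0. The
  system then has exponents \<open>- (1 + 2 * \<gamma>)\<close>, \<open>- \<gamma>\<close> or,
  because \<open>-1 \<le> \<gamma>\<close>, at least 1.\<close>

lemma small_bivectors_imp_regular_exponent_ge_multi:
  assumes "small_bivectors a0 a1 a2" "m \<ge> 2" "s > 0" "a0 < s" "s * \<gamma> < - a1" "s * (1 + 2 * \<gamma>) < - a2" "-1 \<le> \<gamma>"
  shows "ereal \<gamma> \<le> regular_exponent \<Theta> 2"
proof (rule small_bivectors_imp_regular_exponent_ge[OF assms(1) \<open>s > 0\<close>])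
  fix k assume "k \<le> m"
  then consider "k = m" | "Suc k = m" | j where "m = Suc (Suc (k + j))"
    by (metis add_Suc_right le_Suc_ex not0_implies_Suc add_0_right Suc_eq_plus1 add.commute)
  then show "size_exponent a0 a1 a2 k < s * (1 - (real k - real (m - 2)) * (1 + \<gamma>))"
  proof cases
    case 1
    then have eq: "real k - real (m - 2) = 2" using \<open>m \<ge> 2\<close> by (simp add: of_nat_diff)
    have "s * (1 - (real k - real (m - 2)) * (1 + \<gamma>)) = - (s * (1 + 2 * \<gamma>))"
      unfolding eq by (simp add: algebra_simps)
    with 1 assms(6) show ?thesis by (simp add: size_exponent_def)
  next
    case 2
    then have eq: "real k - real (m - 2) = 1" using \<open>m \<ge> 2\<close> by (auto simp: of_nat_diff)
    have "s * (1 - (real k - real (m - 2)) * (1 + \<gamma>)) = - (s * \<gamma>)"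
      unfolding eq by (simp add: algebra_simps)
    moreover have "size_exponent a0 a1 a2 k = a1" using 2 by (simp add: size_exponent_def)
    ultimately show ?thesis using assms(5) by simp
  next
    case 3
    have "s * 1 \<le> s * (1 + real j * (1 + \<gamma>))"
      using \<open>s > 0\<close> \<open>-1 \<le> \<gamma>\<close> by (intro mult_left_mono) auto
    moreover have "size_exponent a0 a1 a2 k = a0" unfolding size_exponent_def using 3 by simp
    moreover have "real k - real (m - 2) = - real j" using 3 by simp
    ultimately show ?thesis using \<open>a0 < s\<close> by simp
  qed
qed

text \<open>For \<open>m = 1\<close> truncation gives \<open>k0 = 0\<close>: the size 0, governed by
  \<open>a1\<close>, has exponent 1 in the system, and the size 1, governed by \<open>a2\<close>,
  has exponent \<open>- \<gamma>\<close>.\<close>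

lemma small_bivectors_imp_regular_exponent_ge_single:
  assumes "small_bivectors a0 a1 a2" "m = 1" "s > 0" "a1 < s" "s * \<gamma> < - a2"
  shows "ereal \<gamma> \<le> regular_exponent \<Theta> 2"
proof (rule small_bivectors_imp_regular_exponent_ge[OF assms(1) \<open>s > 0\<close>])
  fix k assume "k \<le> m"
  with assms have "k = 0 \<or> k = 1" by auto
  then show "size_exponent a0 a1 a2 k < s * (1 - (real k - real (m - 2)) * (1 + \<gamma>))"
    unfolding size_exponent_def using assms(2-) by auto
qed

section \<open>Integer vectors realising values below the first exponents\<close>

lemma uniform_approximation:
  assumes "ereal \<alpha> < uniform_exponent \<Theta> 1"
  shows "\<forall>\<^sub>F t :: real in at_top. \<exists>z. nontrivial z \<and>
    head z \<le> real m * t \<and> defect z \<le> real n * t powr (- \<alpha>)"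
proof -
  obtain \<gamma> where \<gamma>: "\<alpha> < \<gamma>" "\<forall>\<^sub>F t in at_top. system_solvable \<Theta> 1 \<gamma> t"
    using assms unfolding uniform_exponent_def less_SUP_iff by auto
  show ?thesis
    using \<gamma>(2) eventually_ge_at_top[of 1]
  proof eventually_elim
    case (elim t)
    then obtain z where z: "nontrivial z" "head z \<le> real m * t"
      and d: "defect z \<le> real n * t powr (- \<gamma>)"
      using solvable_imp_approximation[of \<gamma> t] by auto
    have "real n * t powr (- \<gamma>) \<le> real n * t powr (- \<alpha>)"
      using \<gamma> elim by (intro mult_left_mono powr_mono) auto
    with z d show ?case by (meson order_trans)
  qed
qed

lemma regular_approximation:
  fixes B :: real
  assumes "ereal \<beta> < regular_exponent \<Theta> 1"
  obtains t :: real and z where "t \<ge> B" "t \<ge> 1" "nontrivial z"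
    "head z \<le> real m * t" "defect z \<le> real n * t powr (- \<beta>)"
proof -
  obtain \<gamma> where \<gamma>: "\<beta> < \<gamma>" "\<exists>\<^sub>F t in at_top. system_solvable \<Theta> 1 \<gamma> t"
    using assms unfolding regular_exponent_def less_SUP_iff by auto
  have "\<exists>\<^sub>F t in at_top. system_solvable \<Theta> 1 \<gamma> t \<and> max B 1 \<le> t"
    using frequently_eventually_frequently[OF \<gamma>(2) eventually_ge_at_top] .
  then obtain t where t: "system_solvable \<Theta> 1 \<gamma> t" "max B 1 \<le> t"
    using frequently_ex by blast
  then obtain z where z: "nontrivial z" "head z \<le> real m * t"
    and d: "defect z \<le> real n * t powr (- \<gamma>)"
    using solvable_imp_approximation[of \<gamma> t] by auto
  have "real n * t powr (- \<gamma>) \<le> real n * t powr (- \<beta>)"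
    using \<gamma> t by (intro mult_left_mono powr_mono) auto
  with z d t show thesis using that[of t z] by auto
qed

lemma uniform_le_regular_exponent: "uniform_exponent \<Theta> p \<le> regular_exponent \<Theta> p"
  unfolding uniform_exponent_def regular_exponent_def
  by (intro SUP_subset_mono) (auto simp: eventually_frequently)

text \<open>A dependent \<open>z\<close> is a nonzero integer multiple of \<open>p\<close>, so
  neither its head nor its defect can be smaller. In contrapositive form, one strict inequality
  makes the bivector nonzero.\<close>

lemma dependent_on_primitive:
  assumes "primitive_on (m + n) p" "nontrivial z" "bivector z p = (\<lambda>_. 0)"
  shows "head p \<le> head z" "defect p \<le> defect z"
proof -
  obtain c where c: "\<And>i. i < m + n \<Longrightarrow> z i = c * p i"
    using primitive_on_wedge_eq_0[OF assms(1,3)] by blast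
  with assms(2) have "c \<noteq> 0" by (auto simp: nontrivial_def)
  then have "1 \<le> \<bar>real_of_int c\<bar>" by linarith
  moreover have "head z = \<bar>real_of_int c\<bar> * head p" "defect z = \<bar>real_of_int c\<bar> * defect p"
    using c by (auto intro!: head_scale defect_scale)
  ultimately show "head p \<le> head z" "defect p \<le> defect z"
    using mult_right_mono[of 1 "\<bar>real_of_int c\<bar>" "head p"]
      mult_right_mono[of 1 "\<bar>real_of_int c\<bar>" "defect p"] by simp_all
qed

text \<open>Dividing an approximation by the gcd of its coordinates does not increase head or defect
  and leaves \<open>t\<close> untouched. For large \<open>t\<close> the defect falls below its
  minimum over heads up to \<open>B\<close>, which forces the head to reach
  \<open>B\<close>.\<close>

lemma primitive_regular_approximation:
  fixes B \<beta> :: real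
  assumes trivial: "\<And>z :: nat \<Rightarrow> int. defect z = 0 \<Longrightarrow> \<not> nontrivial z"
    and \<beta>: "0 < \<beta>" "ereal \<beta> < regular_exponent \<Theta> 1"
  obtains t :: real and p where "B \<le> t" "1 \<le> t" "primitive_on (m + n) p" "nontrivial p"
    "B \<le> head p" "head p \<le> real m * t" "defect p \<le> real n * t powr (- \<beta>)"
proof -
  obtain \<delta> where \<delta>: "0 < \<delta>" "\<And>z. nontrivial z \<Longrightarrow> head z \<le> B \<Longrightarrow> \<delta> \<le> defect z"
    using defect_bounded_below trivial by blast
  have "\<forall>\<^sub>F t in at_top. 2 * real n / \<delta> * t powr (- \<beta>) \<le> t powr 0"
    using \<beta> by (intro eventually_const_powr_le) simp
  then obtain t0 where t0: "\<And>t. t \<ge> t0 \<Longrightarrow> 2 * real n / \<delta> * t powr (- \<beta>) \<le> t powr 0"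
    unfolding eventually_at_top_linorder by blast
  obtain t z where t: "max B t0 \<le> t" "1 \<le> t" and z: "nontrivial z"
    "head z \<le> real m * t" "defect z \<le> real n * t powr (- \<beta>)"
    using regular_approximation[OF \<beta>(2)] by metis
  obtain p g where p: "primitive_on (m + n) p" and g: "g \<noteq> 0" "\<And>i. i < m + n \<Longrightarrow> z i = g * p i"
    using z(1) primitive_on_exists unfolding nontrivial_def by metis
  have "nontrivial p" using z(1) g by (auto simp: nontrivial_def)
  have "1 \<le> \<bar>real_of_int g\<bar>" using g(1) by linarith
  moreover have "head z = \<bar>real_of_int g\<bar> * head p" "defect z = \<bar>real_of_int g\<bar> * defect p"
    using g by (auto intro!: head_scale defect_scale)
  ultimately have le: "head p \<le> head z" "defect p \<le> defect z"
    using mult_right_mono[of 1 "\<bar>real_of_int g\<bar>" "head p"]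
      mult_right_mono[of 1 "\<bar>real_of_int g\<bar>" "defect p"] by simp_all
  have "B \<le> head p"
  proof (rule ccontr)
    assume "\<not> B \<le> head p"
    with \<delta>(2) \<open>nontrivial p\<close> have "\<delta> \<le> defect p" by simp
    also have "\<dots> \<le> real n * t powr (- \<beta>)" using le z by linarith
    finally have "\<delta> \<le> real n * t powr (- \<beta>)" .
    \<comment> \<open>The factor 2 in the choice of \<open>t0\<close> gives at most half of
      \<delta>, hence a strict contradiction.\<close>
    moreover have "2 * (real n * t powr (- \<beta>)) \<le> \<delta>"
      using t0[of t] t \<delta>(1) by (simp add: field_simps)
    ultimately show False using \<delta>(1) by linarith
  qed
  with t z le p \<open>nontrivial p\<close> show thesis
    using that[of t p] by simp
qed

text \<open>The scale is \<open>H = head p\<close>, and \<open>z\<close> is taken at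
  \<open>t = H / (2 * m)\<close>, so its head is at most \<open>H / 2\<close> and it cannot be a
  multiple of \<open>p\<close>. Up to constants both heads are bounded by \<open>H\<close> and the
  defects by \<open>H powr (- \<alpha>)\<close> and \<open>H powr (- \<beta>)\<close>.\<close>

lemma small_bivectors_by_height:
  fixes \<alpha> \<beta> :: real
  assumes trivial: "\<And>z :: nat \<Rightarrow> int. defect z = 0 \<Longrightarrow> \<not> nontrivial z"
    and "0 < \<alpha>" "\<alpha> \<le> \<beta>" "ereal \<alpha> < uniform_exponent \<Theta> 1" "ereal \<beta> < regular_exponent \<Theta> 1"
  shows "small_bivectors 2 (1 - \<alpha>) (- \<alpha> - \<beta>)"
proof -
  have \<beta>: "0 < \<beta>" using assms by simp
  \<comment> \<open>\<open>K\<close> absorbs the constants that arise when both defect bounds are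
    rewritten in terms of \<open>H\<close>.\<close>
  define K where "K = max 1 (max (real n * (2 * m) powr \<alpha>) (real n * m powr \<beta>))"
  have K: "1 \<le> K" "real n * (2 * m) powr \<alpha> \<le> K" "real n * m powr \<beta> \<le> K"
    by (simp_all add: K_def)
  obtain t0 where t0: "\<And>t. t \<ge> t0 \<Longrightarrow> \<exists>z. nontrivial z \<and>
      head z \<le> real m * t \<and> defect z \<le> real n * t powr (- \<alpha>)"
    using uniform_approximation[OF assms(4)] unfolding eventually_at_top_linorder by blast
  show ?thesis
  proof (rule small_bivectorsI[where K = "4 * K\<^sup>2"])
    fix B :: real
    \<comment> \<open>The last entry brings \<open>H / (2 * m)\<close> into the range where the
      uniform approximation exists.\<close>
    define B' where "B' = max (max B 1) (2 * m * t0)"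
    obtain t p where t: "1 \<le> t" and p: "primitive_on (m + n) p" "nontrivial p"
      "B' \<le> head p" "head p \<le> real m * t" "defect p \<le> real n * t powr (- \<beta>)"
      using primitive_regular_approximation[OF trivial \<beta> assms(5), of B'] by blast
    define H where "H = head p"
    have H: "B \<le> H" "1 \<le> H" "2 * m * t0 \<le> H" using p by (auto simp: H_def B'_def)
    have "t0 \<le> H / (2 * m)" using H m_pos by (simp add: field_simps)
    from t0[OF this] obtain z where z: "nontrivial z" "head z \<le> real m * (H / (2 * m))"
      "defect z \<le> real n * (H / (2 * m)) powr (- \<alpha>)" by blast
    have zh: "head z \<le> H / 2" using z(2) m_pos by simp
    define a b where "a = H powr (- \<alpha>)" and "b = H powr (- \<beta>)"
    have ab: "0 \<le> a" "0 \<le> b" "b \<le> a" "a \<le> 1"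
      using assms H by (auto simp: a_def b_def intro: powr_mono ge_one_powr_ge_zero)
        (use powr_mono[of "- \<alpha>" 0 H] in simp)
    have "real n * (H / (2 * m)) powr (- \<alpha>) = (real n * (2 * m) powr \<alpha>) * a"
      using H m_pos by (simp add: a_def powr_divide powr_minus field_simps)
    also have "\<dots> \<le> K * a" using K ab by (intro mult_right_mono) auto
    finally have zd: "defect z \<le> K * a" using z by simp
    \<comment> \<open>Replacing \<open>t\<close> by the smaller \<open>H / m\<close> weakens the
      bound on \<open>defect p\<close> and expresses it in \<open>H\<close>.\<close>
    have "H / m \<le> t" using p m_pos by (simp add: H_def field_simps)
    then have "real n * t powr (- \<beta>) \<le> real n * (H / m) powr (- \<beta>)"
      using assms H m_pos by (intro mult_left_mono powr_mono2') auto
    also have "\<dots> = (real n * m powr \<beta>) * b"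
      using H m_pos by (simp add: b_def powr_divide powr_minus field_simps)
    also have "\<dots> \<le> K * b" using K ab by (intro mult_right_mono) auto
    finally have pd: "defect p \<le> K * b" using p by simp
    have "bivector z p \<noteq> (\<lambda>_. 0)"
      using dependent_on_primitive(1)[OF p(1) z(1)] zh H by (auto simp: H_def)
    moreover have "(head z + defect z) * (head p + defect p) \<le> 4 * K\<^sup>2 * H powr 2"
    proof -
      have "1 * H \<le> K * H" using K H by (intro mult_right_mono) auto
      moreover have "K * a \<le> K * H" "K * b \<le> K * H" using K H ab by (auto intro!: mult_left_mono)
      ultimately have "head z + defect z \<le> 2 * (K * H)" "head p + defect p \<le> 2 * (K * H)"
        using zh zd pd H unfolding H_def[symmetric] by linarith+
      then have "(head z + defect z) * (head p + defect p) \<le> (2 * (K * H)) * (2 * (K * H))"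
        using K H by (intro mult_mono) auto
      then show ?thesis using H by (simp add: power2_eq_square mult_ac)
    qed
    moreover have "head z * defect p + head p * defect z + defect z * defect p \<le> 4 * K\<^sup>2 * H powr (1 - \<alpha>)"
    proof -
      have "head z * defect p + head p * defect z + defect z * defect p \<le>
          H * (K * a) + H * (K * a) + (K * a) * (K * 1)"
      proof (intro add_mono mult_mono)
        show "defect p \<le> K * a" "defect p \<le> K * 1"
          using pd mult_left_mono[of b a K] mult_left_mono[of b 1 K] K ab by linarith+
      qed (use zh zd H K ab in \<open>auto simp: H_def[symmetric]\<close>)
      also have "\<dots> = K * 1 * (H * a) + K * 1 * (H * a) + K * K * (1 * a)" by (simp add: algebra_simps)
      also have "\<dots> \<le> K * K * (H * a) + K * K * (H * a) + K * K * (H * a)"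
        using K H ab by (intro add_mono mult_mono) auto
      also have "\<dots> \<le> 4 * K\<^sup>2 * (H * a)"
        using K H ab by (simp add: power2_eq_square)
      also have "H * a = H powr (1 - \<alpha>)"
        using H by (simp add: a_def powr_diff powr_minus field_simps)
      finally show ?thesis .
    qed
    moreover have "defect z * defect p \<le> 4 * K\<^sup>2 * H powr (- \<alpha> - \<beta>)"
    proof -
      have "defect z * defect p \<le> (K * a) * (K * b)"
        using zd pd K ab by (intro mult_mono) auto
      also have "\<dots> = K\<^sup>2 * (a * b)"
        by (simp add: power2_eq_square mult_ac)
      also have "a * b = H powr (- \<alpha> - \<beta>)"
        by (simp add: a_def b_def flip: powr_add)
      also have "K\<^sup>2 * H powr (- \<alpha> - \<beta>) \<le> 4 * K\<^sup>2 * H powr (- \<alpha> - \<beta>)"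
        by (intro mult_right_mono) auto
      finally show ?thesis .
    qed
    ultimately show "\<exists>H\<ge>B. \<exists>z z' :: nat \<Rightarrow> int. bivector z z' \<noteq> (\<lambda>_. 0) \<and>
      (head z + defect z) * (head z' + defect z') \<le> 4 * K\<^sup>2 * H powr 2 \<and>
      head z * defect z' + head z' * defect z + defect z * defect z' \<le> 4 * K\<^sup>2 * H powr (1 - \<alpha>) \<and>
      defect z * defect z' \<le> 4 * K\<^sup>2 * H powr (- \<alpha> - \<beta>)"
      using H(1) by blast
  qed
qed

text \<open>The scale is \<open>H = 1 / defect p\<close>, and \<open>z\<close> is taken at
  \<open>T = (2 * n * H) powr (1 / \<alpha>)\<close>, where its defect is at most half of
  \<open>defect p\<close>; hence independence. Inverting the power laws bounds the heads by
  multiples of \<open>H powr (1 / \<alpha>)\<close> and \<open>H powr (1 / \<beta>)\<close>, of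
  which the first is the larger.\<close>

lemma small_bivectors_by_defect:
  fixes \<alpha> \<beta> :: real
  assumes trivial: "\<And>z :: nat \<Rightarrow> int. defect z = 0 \<Longrightarrow> \<not> nontrivial z"
    and "0 < \<alpha>" "\<alpha> \<le> \<beta>" "ereal \<alpha> < uniform_exponent \<Theta> 1" "ereal \<beta> < regular_exponent \<Theta> 1"
  shows "small_bivectors (1 / \<alpha> + 1 / \<beta>) (1 / \<alpha> - 1) (- 2)"
proof -
  have \<beta>: "0 < \<beta>" using assms by simp
  define K where "K = max 1 (max (real m * (2 * n) powr (1 / \<alpha>)) (real m * n powr (1 / \<beta>)))"
  have K: "1 \<le> K" "real m * (2 * n) powr (1 / \<alpha>) \<le> K" "real m * n powr (1 / \<beta>) \<le> K"
    by (simp_all add: K_def)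
  have n: "1 \<le> real n" using n_pos by simp
  obtain t1 where t1: "\<And>t. t \<ge> t1 \<Longrightarrow> \<exists>z. nontrivial z \<and>
      head z \<le> real m * t \<and> defect z \<le> real n * t powr (- \<alpha>)"
    using uniform_approximation[OF assms(4)] unfolding eventually_at_top_linorder by blast
  \<comment> \<open>Positivity of \<open>t0\<close> allows it to be recovered from
    \<open>t0 powr \<alpha>\<close>.\<close>
  define t0 where "t0 = max t1 1"
  show ?thesis
  proof (rule small_bivectorsI[where K = "4 * K\<^sup>2"])
    fix B :: real
    \<comment> \<open>Since \<open>t powr \<beta> \<le> n * H\<close>, asking for \<open>t\<close>
      at least \<open>(n * B') powr (1 / \<beta>)\<close> ensures \<open>B' \<le> H\<close>. The
      last entry of \<open>B'\<close> then yields \<open>t1 \<le> T\<close>.\<close>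
    define B' where "B' = max (max B 1) (t0 powr \<alpha>)"
    obtain t p where t: "(n * B') powr (1 / \<beta>) \<le> t" "1 \<le> t" and p: "primitive_on (m + n) p" "nontrivial p"
      "head p \<le> real m * t" "defect p \<le> real n * t powr (- \<beta>)"
      using primitive_regular_approximation[OF trivial \<beta> assms(5), of "(n * B') powr (1 / \<beta>)"] by blast
    have dp: "0 < defect p" using trivial[of p] p(2) defect_nonneg[of p] by linarith
    define H where "H = 1 / defect p"
    have dpH: "defect p = 1 / H" by (simp add: H_def)
    have tH: "t powr \<beta> \<le> n * H"
      using p(4) dp t by (simp add: H_def powr_minus field_simps)
    have "n * B' = ((n * B') powr (1 / \<beta>)) powr \<beta>"
      using assms n by (simp add: powr_powr B'_def)
    also have "\<dots> \<le> t powr \<beta>" using t assms by (intro powr_mono2) auto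
    finally have "n * B' \<le> n * H" using tH by simp
    then have "B' \<le> H" using n by simp
    then have H: "B \<le> H" "1 \<le> H" "t0 powr \<alpha> \<le> H" by (auto simp: B'_def)
    have "t = (t powr \<beta>) powr (1 / \<beta>)" using assms t by (simp add: powr_powr)
    also have "\<dots> \<le> (n * H) powr (1 / \<beta>)" using tH assms by (intro powr_mono2) auto
    finally have t_le: "t \<le> (n * H) powr (1 / \<beta>)" .
    define T where "T = (2 * n * H) powr (1 / \<alpha>)"
    have "t0 = (t0 powr \<alpha>) powr (1 / \<alpha>)" using assms by (simp add: powr_powr t0_def)
    also have "\<dots> \<le> T"
      unfolding T_def
    proof (intro powr_mono2)
      have "1 * H \<le> 2 * n * H" using H n by (intro mult_right_mono) auto
      with H(3) show "t0 powr \<alpha> \<le> 2 * n * H" by linarith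
    qed (use assms in auto)
    finally have "t1 \<le> T" by (simp add: t0_def)
    from t1[OF this] obtain z where z: "nontrivial z" "head z \<le> real m * T"
      "defect z \<le> real n * T powr (- \<alpha>)" by blast
    have zd: "defect z \<le> 1 / (2 * H)"
      using z(3) assms H n by (simp add: T_def powr_powr powr_minus_divide)
    define x y where "x = H powr (1 / \<alpha>)" and "y = H powr (1 / \<beta>)"
    have xy: "1 \<le> y" "y \<le> x" "1 \<le> x"
      using assms H by (auto simp: x_def y_def frac_le intro!: powr_mono ge_one_powr_ge_zero)
    have "real m * T = (real m * (2 * n) powr (1 / \<alpha>)) * x"
      using H by (simp add: T_def x_def powr_mult)
    also have "\<dots> \<le> K * x" using K xy by (intro mult_right_mono) auto
    finally have zh: "head z \<le> K * x" using z by simp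
    have "real m * t \<le> real m * (n * H) powr (1 / \<beta>)" using t_le by (intro mult_left_mono) auto
    also have "\<dots> = (real m * n powr (1 / \<beta>)) * y"
      using H by (simp add: y_def powr_mult)
    also have "\<dots> \<le> K * y" using K xy by (intro mult_right_mono) auto
    finally have ph: "head p \<le> K * y" using p by simp
    define u where "u = 1 / H"
    have u: "0 < u" "u \<le> 1" using H by (simp_all add: u_def)
    have zu: "defect z \<le> u" and pu: "defect p = u" and zu2: "defect z \<le> u / 2"
      using zd dpH H by (simp_all add: u_def field_simps)
    have "bivector z p \<noteq> (\<lambda>_. 0)"
      using dependent_on_primitive(2)[OF p(1) z(1)] zu2 pu u by auto
    moreover have "(head z + defect z) * (head p + defect p) \<le> 4 * K\<^sup>2 * H powr (1 / \<alpha> + 1 / \<beta>)"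
    proof -
      have "1 \<le> K * x" "1 \<le> K * y" using K xy by (simp_all add: mult_ge1_I)
      then have "(head z + defect z) * (head p + defect p) \<le> (2 * (K * x)) * (2 * (K * y))"
        using zh zu ph pu u by (intro mult_mono) auto
      then show ?thesis using H by (simp add: power2_eq_square x_def y_def powr_add mult_ac)
    qed
    moreover have "head z * defect p + head p * defect z + defect z * defect p \<le> 4 * K\<^sup>2 * H powr (1 / \<alpha> - 1)"
    proof -
      have "head z * defect p + head p * defect z + defect z * defect p \<le>
          (K * x) * u + (K * x) * u + 1 * u"
      proof (intro add_mono mult_mono)
        show "head p \<le> K * x" using ph mult_left_mono[of y x K] xy K by linarith
      qed (use zh zu pu u K xy in auto)
      also have "\<dots> = K * 1 * (x * u) + K * 1 * (x * u) + 1 * 1 * (1 * u)" by simp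
      also have "\<dots> \<le> K * K * (x * u) + K * K * (x * u) + K * K * (x * u)"
        using K xy u by (intro add_mono mult_mono) auto
      also have "\<dots> \<le> 4 * K\<^sup>2 * (x * u)"
        using K xy u by (simp add: power2_eq_square)
      also have "x * u = H powr (1 / \<alpha> - 1)"
        using H by (simp add: x_def u_def powr_diff)
      finally show ?thesis .
    qed
    moreover have "defect z * defect p \<le> 4 * K\<^sup>2 * H powr (- 2)"
    proof -
      have "defect z * defect p \<le> 1 * 1 * (u * u)"
        using zu pu u by simp
      also have "\<dots> \<le> K * K * (u * u)" using K u by (intro mult_mono) auto
      also have "\<dots> \<le> 4 * K\<^sup>2 * (u * u)" using K u by (simp add: power2_eq_square)
      also have "u * u = H powr (- 2)"
        using H by (simp add: u_def powr_minus_divide power2_eq_square)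
      finally show ?thesis .
    qed
    ultimately show "\<exists>H\<ge>B. \<exists>z z' :: nat \<Rightarrow> int. bivector z z' \<noteq> (\<lambda>_. 0) \<and>
      (head z + defect z) * (head z' + defect z') \<le> 4 * K\<^sup>2 * H powr (1 / \<alpha> + 1 / \<beta>) \<and>
      head z * defect z' + head z' * defect z + defect z * defect z' \<le> 4 * K\<^sup>2 * H powr (1 / \<alpha> - 1) \<and>
      defect z * defect z' \<le> 4 * K\<^sup>2 * H powr (- 2)"
      using H(1) by blast
  qed
qed

text \<open>One fixed bivector serves every \<open>H\<close>: its products with \<open>m - 1\<close>
  or \<open>m\<close> columns vanish, so \<open>a1\<close> and \<open>a2\<close> are arbitrary, and
  the remaining products do not depend on \<open>H\<close>.\<close>

lemma small_bivectors_of_two_solutions: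
  fixes z z' :: "nat \<Rightarrow> int"
  assumes "defect z = 0" "defect z' = 0" "bivector z z' \<noteq> (\<lambda>_. 0)"
  shows "small_bivectors 0 a1 a2"
proof (rule small_bivectorsI[where K = "head z * head z'"])
  fix B :: real
  \<comment> \<open>The scale must be nonzero because \<open>0 powr 0 = 0\<close>.\<close>
  have "max B 1 \<ge> B" "max B 1 \<noteq> 0" by auto
  with assms show "\<exists>H\<ge>B. \<exists>u v :: nat \<Rightarrow> int. bivector u v \<noteq> (\<lambda>_. 0) \<and>
      (head u + defect u) * (head v + defect v) \<le> head z * head z' * H powr 0 \<and>
      head u * defect v + head v * defect u + defect u * defect v \<le> head z * head z' * H powr a1 \<and>
      defect u * defect v \<le> head z * head z' * H powr a2"
    by (intro exI[of _ "max B 1"] exI[of _ z] exI[of _ z'] conjI) simp_all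
qed

section \<open>Dirichlet's theorem and the lattice of solutions\<close>

text \<open>This is the way back from approximations to the first system, at the price of a
  constant. With fewer than \<open>m\<close> columns the exponent is at least 1, as
  \<open>-1 \<le> \<gamma>\<close>, so the bound by \<open>t\<close> suffices there.\<close>

lemma approximation_imp_solvable:
  obtains C where "1 \<le> C" "\<And>z \<gamma> t. nontrivial z \<Longrightarrow> 1 \<le> t \<Longrightarrow> -1 \<le> \<gamma> \<Longrightarrow>
    C * (head z + defect z) \<le> t \<Longrightarrow> C * defect z \<le> t powr (- \<gamma>) \<Longrightarrow> system_solvable \<Theta> 1 \<gamma> t"
proof -
  obtain C where C: "1 \<le> C"
    and C0: "\<And>z \<sigma> I. \<sigma> \<subseteq> {..<m} \<Longrightarrow> I \<subseteq> {..<m + n} \<Longrightarrow>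
      \<bar>wedge (L_wedge \<Theta> \<sigma>) (one_vector (m + n) z) I\<bar> \<le> C * (head z + defect z)"
    and C1: "\<And>z I. I \<subseteq> {..<m + n} \<Longrightarrow>
      \<bar>wedge (L_wedge \<Theta> {..<m}) (one_vector (m + n) z) I\<bar> \<le> C * defect z"
    using wedge_L_wedge_bounds by metis
  have "system_solvable \<Theta> 1 \<gamma> t" if z: "nontrivial z" and t: "1 \<le> t" and \<gamma>: "-1 \<le> \<gamma>"
    and h: "C * (head z + defect z) \<le> t" and d: "C * defect z \<le> t powr (- \<gamma>)" for z \<gamma> t
  proof -
    let ?Z = "one_vector (m + n) (\<lambda>i. real_of_int (z i))"
    have "?Z \<in> integer_p_vectors (m + n) 1"
      using one_vector_integer one_vector_p_vectors by (simp add: integer_p_vectors_def)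
    moreover have "?Z \<noteq> (\<lambda>_. 0)"
    proof
      assume *: "?Z = (\<lambda>_. 0)"
      obtain i where "i < m + n" "z i \<noteq> 0" using z by (auto simp: nontrivial_def)
      with fun_cong[OF *, of "{i}"] show False by simp
    qed
    moreover have "\<bar>wedge (L_wedge \<Theta> \<sigma>) ?Z I\<bar> \<le> t powr (1 - (real (card \<sigma>) - real (m - 1)) * (1 + \<gamma>))"
      if \<sigma>: "\<sigma> \<subseteq> {..<m}" and I: "I \<subseteq> {..<m + n}" for \<sigma> I
    proof (cases "card \<sigma> = m")
      case True
      then have "1 - (real (card \<sigma>) - real (m - 1)) * (1 + \<gamma>) = - \<gamma>"
        using m_pos by (simp add: of_nat_diff)
      moreover have "\<sigma> = {..<m}" using True \<sigma> card_eq_m by blast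
      ultimately show ?thesis using order_trans[OF C1 d] I by simp
    next
      case False
      with card_le_m[OF \<sigma>] have "real (card \<sigma>) - real (m - 1) \<le> 0" by linarith
      then have "(real (card \<sigma>) - real (m - 1)) * (1 + \<gamma>) \<le> 0"
        using \<gamma> by (intro mult_nonpos_nonneg) auto
      then have "t powr 1 \<le> t powr (1 - (real (card \<sigma>) - real (m - 1)) * (1 + \<gamma>))"
        using t by (intro powr_mono) auto
      moreover have "\<bar>wedge (L_wedge \<Theta> \<sigma>) ?Z I\<bar> \<le> t" using order_trans[OF C0 h] \<sigma> I by simp
      ultimately show ?thesis using t by simp
    qed
    ultimately show ?thesis unfolding system_solvable_iff by blast
  qed
  with C show thesis using that by blast
qed

text \<open>Dirichlet's theorem is applied to the first column of \<Theta> alone, with the other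
  entries of the head set to 0. The resulting exponent is weak, but only its positivity
  matters.\<close>

lemma simultaneous_approximation:
  assumes "N > 0"
  obtains z where "nontrivial z" "head z \<le> real N ^ n" "defect z \<le> real n / real N"
proof -
  obtain q p where q: "0 < q" "q \<le> int (N ^ n)"
    and p: "\<And>i. i < n \<Longrightarrow> \<bar>of_int q * \<Theta> $$ (i, 0) - of_int (p i)\<bar> < 1 / N"
    using Dirichlet_approx_simult[OF assms, of n "\<lambda>i. \<Theta> $$ (i, 0)"] by blast
  define z where "z j = (if j = 0 then q else if j < m then 0 else p (j - m))" for j
  have "nontrivial z" using q m_pos by (auto simp: nontrivial_def z_def intro!: exI[of _ 0])
  moreover have "head z \<le> real N ^ n"
  proof -
    have "head z = (\<Sum>i<m. if i = 0 then real_of_int q else 0)"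
      unfolding head_def using q by (intro sum.cong) (auto simp: z_def)
    also have "\<dots> = real_of_int q" using m_pos by simp
    also have "\<dots> \<le> real_of_int (int (N ^ n))" using q by (simp only: of_int_le_iff)
    finally show ?thesis by simp
  qed
  moreover have "defect z \<le> real n / real N"
  proof -
    have "\<bar>residual z j\<bar> \<le> 1 / N" if j: "j \<in> {m..<m+n}" for j
    proof -
      have "(\<Sum>i<m. \<Theta> $$ (j - m, i) * real_of_int (z i)) =
          (\<Sum>i<m. if i = 0 then \<Theta> $$ (j - m, 0) * real_of_int q else 0)"
        by (intro sum.cong) (auto simp: z_def)
      also have "\<dots> = \<Theta> $$ (j - m, 0) * real_of_int q" using m_pos by simp
      finally have "residual z j = p (j - m) - q * \<Theta> $$ (j - m, 0)"
        using j m_pos by (simp add: residual_def z_def)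
      moreover have "j - m < n" using j by auto
      ultimately show ?thesis using p[of "j - m"] by (simp add: abs_minus_commute)
    qed
    then show ?thesis
      unfolding defect_def using sum_mono[of "{m..<m+n}" "\<lambda>j. \<bar>residual z j\<bar>" "\<lambda>_. 1 / real N"] by simp
  qed
  ultimately show thesis using that by blast
qed

lemma uniform_exponent_pos: "0 < uniform_exponent \<Theta> 1"
proof -
  obtain C where C: "1 \<le> C" and solv: "\<And>z \<gamma> t. nontrivial z \<Longrightarrow> 1 \<le> t \<Longrightarrow> -1 \<le> \<gamma> \<Longrightarrow>
    C * (head z + defect z) \<le> t \<Longrightarrow> C * defect z \<le> t powr (- \<gamma>) \<Longrightarrow> system_solvable \<Theta> 1 \<gamma> t"
    using approximation_imp_solvable by metis
  \<comment> \<open>With \<open>N\<close> about \<open>t powr (2 * \<gamma>)\<close>, the head is at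
    most \<open>N ^ n \<le> t powr (1 / 2)\<close> and the defect is of order
    \<open>t powr (- (2 * \<gamma>))\<close>; both leave a gap in the exponent for the
    constants.\<close>
  define \<gamma> where "\<gamma> = 1 / (4 * real n)"
  have n: "0 < real n" using n_pos by simp
  then have \<gamma>: "0 < \<gamma>" by (simp add: \<gamma>_def)
  have "\<forall>\<^sub>F t in at_top. C * (1 + n) * t powr (1 / 2) \<le> t powr 1"
    by (intro eventually_const_powr_le) simp
  moreover have "\<forall>\<^sub>F t in at_top. 2 * C * n * t powr (- (2 * \<gamma>)) \<le> t powr (- \<gamma>)"
    using \<gamma> by (intro eventually_const_powr_le) simp
  ultimately have "\<forall>\<^sub>F t in at_top. system_solvable \<Theta> 1 \<gamma> t"
    using eventually_ge_at_top[of 1]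
  proof eventually_elim
    case (elim t)
    define x where "x = t powr (2 * \<gamma>)"
    have x: "1 \<le> x" using elim \<gamma> by (simp add: x_def ge_one_powr_ge_zero)
    \<comment> \<open>Rounding down loses at most a factor 2, because \<open>x\<close> is at least
      1.\<close>
    define N where "N = nat \<lfloor>x\<rfloor>"
    have "1 \<le> \<lfloor>x\<rfloor>" using x by simp
    then have N: "0 < N" "real N \<le> x" "x \<le> 2 * real N"
      unfolding N_def by linarith+
    obtain z where z: "nontrivial z" "head z \<le> real N ^ n" "defect z \<le> real n / real N"
      using simultaneous_approximation[OF N(1)] by metis
    have "real N ^ n \<le> x ^ n" using N by (intro power_mono) auto
    also have "x ^ n = t powr (1 / 2)"
      using elim n by (simp add: x_def \<gamma>_def powr_power)
    finally have h: "head z \<le> t powr (1 / 2)" using z by simp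
    have "real n / real N \<le> real n / 1" using N n by (intro divide_left_mono) auto
    also have "\<dots> \<le> n * t powr (1 / 2)" using elim n by (simp add: ge_one_powr_ge_zero)
    finally have "head z + defect z \<le> (1 + n) * t powr (1 / 2)"
      using h z by (simp add: algebra_simps)
    then have "C * (head z + defect z) \<le> C * ((1 + n) * t powr (1 / 2))"
      using C by (intro mult_left_mono) auto
    then have 1: "C * (head z + defect z) \<le> t"
      using elim by (simp add: mult_ac)
    have "real n / real N \<le> 2 * n / x"
      using N n x by (simp add: field_simps)
    then have "C * defect z \<le> C * (2 * n / x)"
      using C z by (intro mult_left_mono) auto
    also have "\<dots> = 2 * C * n * t powr (- (2 * \<gamma>))"
      by (simp add: x_def powr_minus field_simps)
    also have "\<dots> \<le> t powr (- \<gamma>)" using elim by simp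
    finally show ?case using solv[OF z(1) _ _ 1] elim \<gamma> by simp
  qed
  then have "ereal \<gamma> \<le> uniform_exponent \<Theta> 1"
    unfolding uniform_exponent_def by (intro SUP_upper) simp
  with \<gamma> show ?thesis by (metis ereal_less(2) less_le_trans)
qed

section \<open>The lattice of integer solutions\<close>

lemma defect_eq_0_iff:
  "defect z = 0 \<longleftrightarrow> (\<forall>j<n. z (m + j) = (\<Sum>i<m. \<Theta> $$ (j, i) * z i))"
proof -
  have "defect z = 0 \<longleftrightarrow> (\<forall>j\<in>{m..<m+n}. residual z j = 0)"
    unfolding defect_def by (subst sum_nonneg_eq_0_iff) auto
  also have "{m..<m+n} = (+) m ` {..<n}"
    by (simp add: lessThan_atLeast0 add.commute)
  also have "(\<forall>j\<in>(+) m ` {..<n}. residual z j = 0) \<longleftrightarrow>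
      (\<forall>j<n. z (m + j) = (\<Sum>i<m. \<Theta> $$ (j, i) * z i))"
    by (auto simp: residual_def)
  finally show ?thesis .
qed

lemma integer_solutions_iff:
  "v \<in> integer_solutions \<Theta> \<longleftrightarrow> v \<in> carrier_vec (m + n) \<and> defect (\<lambda>i. real_of_int (v $ i)) = 0"
proof
  assume "v \<in> integer_solutions \<Theta>"
  then obtain x y where v: "v = x @\<^sub>v y" and xy: "x \<in> carrier_vec m" "y \<in> carrier_vec n"
    and eq: "\<Theta> *\<^sub>v map_vec real_of_int x = map_vec real_of_int y"
    by (auto simp: integer_solutions_def)
  have "real_of_int (y $ j) = (\<Sum>i<m. \<Theta> $$ (j, i) * real_of_int (x $ i))" if "j < n" for j
  proof -
    have "real_of_int (y $ j) = (\<Theta> *\<^sub>v map_vec real_of_int x) $ j"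
      using that xy by (simp add: eq)
    also have "\<dots> = (\<Sum>i<m. \<Theta> $$ (j, i) * real_of_int (x $ i))"
      using that xy by (simp add: scalar_prod_def lessThan_atLeast0)
    finally show ?thesis .
  qed
  then show "v \<in> carrier_vec (m + n) \<and> defect (\<lambda>i. real_of_int (v $ i)) = 0"
    using xy by (auto simp: v defect_eq_0_iff intro!: sum.cong)
next
  assume v: "v \<in> carrier_vec (m + n) \<and> defect (\<lambda>i. real_of_int (v $ i)) = 0"
  define x y where "x = Matrix.vec m (\<lambda>i. v $ i)" and "y = Matrix.vec n (\<lambda>j. v $ (m + j))"
  have "v = x @\<^sub>v y"
    using v by (intro eq_vecI) (auto simp: x_def y_def)
  moreover have "\<Theta> *\<^sub>v map_vec real_of_int x = map_vec real_of_int y"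
    using v by (intro eq_vecI)
      (auto simp: x_def y_def defect_eq_0_iff scalar_prod_def lessThan_atLeast0)
  moreover have "x \<in> carrier_vec m" "y \<in> carrier_vec n" by (simp_all add: x_def y_def)
  ultimately show "v \<in> integer_solutions \<Theta>"
    by (auto simp: integer_solutions_def)
qed

text \<open>Let \<open>p\<close> be primitive and proportional to \<open>z\<close>. If every
  solution were dependent on \<open>p\<close>, each would be an integer multiple of it, and the
  solutions would form the rank one lattice spanned by \<open>p\<close>.\<close>

lemma rank_one_or_independent_solutions:
  assumes not_rank_one: "\<not> rank_one_lattice (m + n) (integer_solutions \<Theta>)"
    and z: "defect z = 0" "nontrivial z"
  obtains u p :: "nat \<Rightarrow> int" where "defect u = 0" "defect p = 0" "bivector u p \<noteq> (\<lambda>_. 0)"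
proof -
  obtain p g where p: "primitive_on (m + n) p" and g: "g \<noteq> 0" "\<And>i. i < m + n \<Longrightarrow> z i = g * p i"
    using z(2) primitive_on_exists unfolding nontrivial_def by metis
  have "defect z = \<bar>real_of_int g\<bar> * defect p" by (rule defect_scale) (simp add: g)
  then have dp: "defect p = 0" using z g by simp
  have np: "nontrivial p" using z(2) g by (auto simp: nontrivial_def)
  have "\<exists>u :: nat \<Rightarrow> int. defect u = 0 \<and> bivector u p \<noteq> (\<lambda>_. 0)"
  proof (rule ccontr)
    assume no: "\<not> ?thesis"
    define v where "v = Matrix.vec (m + n) p"
    have "v \<noteq> 0\<^sub>v (m + n)"
    proof
      assume *: "v = 0\<^sub>v (m + n)"
      obtain i where i: "i < m + n" "p i \<noteq> 0" using np by (auto simp: nontrivial_def)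
      then have "p i = v $ i" by (simp add: v_def)
      with i show False by (simp add: *)
    qed
    moreover have "integer_solutions \<Theta> = range (\<lambda>c :: int. c \<cdot>\<^sub>v v)"
    proof (intro equalityI subsetI)
      fix w assume "w \<in> integer_solutions \<Theta>"
      then have w: "w \<in> carrier_vec (m + n)" "defect (\<lambda>i. real_of_int (w $ i)) = 0"
        by (simp_all add: integer_solutions_iff)
      with no have "bivector (\<lambda>i. w $ i) p = (\<lambda>_. 0)" by blast
      then obtain c where "\<forall>i<m+n. w $ i = c * p i"
        using primitive_on_wedge_eq_0[OF p] by blast
      with w have "w = c \<cdot>\<^sub>v v" by (intro eq_vecI) (auto simp: v_def)
      then show "w \<in> range (\<lambda>c :: int. c \<cdot>\<^sub>v v)" by blast
    next
      fix w assume "w \<in> range (\<lambda>c :: int. c \<cdot>\<^sub>v v)"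
      then obtain c where w: "w = c \<cdot>\<^sub>v v" by blast
      have "defect (\<lambda>i. real_of_int (w $ i)) = \<bar>real_of_int c\<bar> * defect p"
        by (rule defect_scale) (simp add: w v_def)
      with dp show "w \<in> integer_solutions \<Theta>"
        by (simp add: integer_solutions_iff) (simp add: w v_def)
    qed
    moreover have "v \<in> carrier_vec (m + n)" by (simp add: v_def)
    ultimately have "rank_one_lattice (m + n) (integer_solutions \<Theta>)"
      unfolding rank_one_lattice_def by blast
    with not_rank_one show False ..
  qed
  with dp show thesis using that by blast
qed

end

section \<open>Passage to the exponents\<close>

lemma ereal_le_of_tendsto:
  fixes f :: "real \<Rightarrow> real"
  assumes "(f \<longlongrightarrow> L) F" "\<forall>\<^sub>F x in F. ereal (f x) \<le> c" "F \<noteq> bot"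
  shows "ereal L \<le> c"
  using tendsto_upperbound[of "\<lambda>x. ereal (f x)" "ereal L" F c] assms by (simp add: tendsto_ereal)

lemma ereal_eq_top_of_filterlim:
  fixes f :: "real \<Rightarrow> real"
  assumes "filterlim f at_top F" "\<forall>\<^sub>F x in F. ereal (f x) \<le> c" "F \<noteq> bot"
  shows "c = \<infinity>"
proof (rule ereal_top)
  fix B
  have "\<forall>\<^sub>F x in F. B \<le> f x \<and> ereal (f x) \<le> c"
    using assms by (auto simp: filterlim_at_top eventually_conj_iff)
  then obtain x where "B \<le> f x" "ereal (f x) \<le> c"
    using assms(3) eventually_happens' by blast
  then show "ereal B \<le> c" by (meson ereal_less_eq(3) order_trans)
qed

lemma eventually_at_right_0_less:
  fixes r :: real
  assumes "0 < r"
  shows "\<forall>\<^sub>F x in at_right 0. 0 < x \<and> x < r"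
  using eventually_at_right_real[OF assms] by eventually_elim auto

text \<open>The bound is known only strictly below the exponents and passes to the limit.
  Approaching by \<open>r - 2 * e\<close> and \<open>R - e\<close> keeps \<alpha> < \<beta> even
  when \<open>a = b\<close>. At \<open>a = 1\<close> the \<open>ereal\<close> quotient is infinite,
  so the bounds must be unbounded.\<close>

lemma quotient_le_of_open_bounds_single:
  fixes a b c :: ereal
  assumes "0 < a" "a \<le> b"
    and above_1: "1 < a \<Longrightarrow> c = \<infinity>"
    and bound: "\<And>\<alpha> \<beta>. 0 < \<alpha> \<Longrightarrow> \<alpha> < \<beta> \<Longrightarrow> \<alpha> < 1 \<Longrightarrow> ereal \<alpha> < a \<Longrightarrow> ereal \<beta> < b \<Longrightarrow>
      ereal ((\<alpha> + \<beta>) / (1 - \<alpha>)) \<le> c"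
  shows "(b + a) / (1 - a) \<le> c"
proof -
  consider "1 < a" | "a = 1" | r where "a = ereal r" "0 < r" "r < 1"
    using assms(1) by (cases a) (auto simp: one_ereal_def, meson linorder_cases)
  then show ?thesis
  proof cases
    case 1
    with above_1 show ?thesis by simp
  next
    case 2
    have "c = \<infinity>"
    proof (rule ereal_eq_top_of_filterlim)
      \<comment> \<open>Since \<open>b\<close> is at least \<open>a = 1\<close>, the value
        \<open>1 - e\<close> lies below \<open>b\<close>, and finite and infinite \<open>b\<close>
        need no separation.\<close>
      show "filterlim (\<lambda>e::real. ((1 - 2 * e) + (1 - e)) / (1 - (1 - 2 * e))) at_top (at_right 0)"
        by real_asymp
      show "\<forall>\<^sub>F e in at_right 0. ereal (((1 - 2 * e) + (1 - e)) / (1 - (1 - 2 * e))) \<le> c"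
      proof (rule eventually_mono[OF eventually_at_right_0_less[of "1 / 2"]])
        fix e :: real assume e: "0 < e \<and> e < 1 / 2"
        have "ereal (1 - 2 * e) < a" "ereal (1 - e) < 1"
          using e by (simp_all add: 2 one_ereal_def)
        moreover from this have "ereal (1 - e) < b"
          using assms(2) 2 less_le_trans by blast
        ultimately show "ereal (((1 - 2 * e) + (1 - e)) / (1 - (1 - 2 * e))) \<le> c"
          using e by (intro bound) auto
      qed simp
    qed simp
    then show ?thesis by simp
  next
    case 3
    show ?thesis
    proof (cases b)
      case (real R)
      have "r \<le> R" using assms(2) 3 real by simp
      have "ereal ((r + R) / (1 - r)) \<le> c"
      proof (rule ereal_le_of_tendsto)
        show "((\<lambda>e. ((r - 2 * e) + (R - e)) / (1 - (r - 2 * e))) \<longlongrightarrow> (r + R) / (1 - r)) (at_right 0)"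
          using 3 by (auto intro!: tendsto_eq_intros)
        show "\<forall>\<^sub>F e in at_right 0. ereal (((r - 2 * e) + (R - e)) / (1 - (r - 2 * e))) \<le> c"
          using eventually_at_right_0_less[OF half_gt_zero[OF 3(2)]]
          by (rule eventually_mono, intro bound) (use 3 real \<open>r \<le> R\<close> in auto)
      qed simp
      moreover have "(b + a) / (1 - a) = ereal ((r + R) / (1 - r))"
        using 3 real by (simp add: one_ereal_def add.commute)
      ultimately show ?thesis by simp
    next
      case PInf
      have "c = \<infinity>"
      proof (rule ereal_eq_top_of_filterlim)
        show "filterlim (\<lambda>k. (r / 2 + k) / (1 - r / 2)) at_top at_top"
          using 3 by real_asymp
        show "\<forall>\<^sub>F k in at_top. ereal ((r / 2 + k) / (1 - r / 2)) \<le> c"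
          using eventually_gt_at_top[of "r / 2"]
          by (rule eventually_mono, intro bound) (use 3 PInf in auto)
      qed simp
      then show ?thesis by simp
    next
      case MInf
      with assms show ?thesis by simp
    qed
  qed
qed

text \<open>Along the approximation \<alpha> < \<beta> keeps the denominator above 2. Finiteness of
  \<open>a\<close> avoids a difference of two infinities; for infinite \<open>b\<close> the quotient
  is 0, again a limit of the bounds.\<close>

lemma quotient_le_of_open_bounds_height:
  fixes a b c :: ereal
  assumes "0 < a" "a \<le> b" "a \<noteq> \<infinity>"
    and bound: "\<And>\<alpha> \<beta>. 0 < \<alpha> \<Longrightarrow> \<alpha> < \<beta> \<Longrightarrow> ereal \<alpha> < a \<Longrightarrow> ereal \<beta> < b \<Longrightarrow>
      ereal ((\<alpha> - 1) / (2 + \<beta> - \<alpha>)) \<le> c"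
  shows "(a - 1) / (2 + b - a) \<le> c"
proof -
  obtain r where r: "a = ereal r" "0 < r"
    using assms(1,3) by (cases a) auto
  show ?thesis
  proof (cases b)
    case (real R)
    have "r \<le> R" using assms(2) r real by simp
    have "ereal ((r - 1) / (2 + R - r)) \<le> c"
    proof (rule ereal_le_of_tendsto)
      show "((\<lambda>e. ((r - 2 * e) - 1) / (2 + (R - e) - (r - 2 * e))) \<longlongrightarrow> (r - 1) / (2 + R - r)) (at_right 0)"
        using \<open>r \<le> R\<close> by (auto intro!: tendsto_eq_intros)
      show "\<forall>\<^sub>F e in at_right 0. ereal (((r - 2 * e) - 1) / (2 + (R - e) - (r - 2 * e))) \<le> c"
        using eventually_at_right_0_less[OF half_gt_zero[OF r(2)]]
        by (rule eventually_mono, intro bound) (use r real \<open>r \<le> R\<close> in auto)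
    qed simp
    moreover have "(a - 1) / (2 + b - a) = ereal ((r - 1) / (2 + R - r))"
    proof -
      have "2 + ereal R - ereal r = ereal (2 + R - r)"
        by (simp only: numeral_eq_ereal plus_ereal.simps ereal_minus)
      then show ?thesis using r real \<open>r \<le> R\<close> by (simp add: one_ereal_def)
    qed
    ultimately show ?thesis by simp
  next
    case PInf
    have "ereal 0 \<le> c"
    proof (rule ereal_le_of_tendsto)
      show "((\<lambda>k. (r / 2 - 1) / (2 + k - r / 2)) \<longlongrightarrow> 0) at_top"
        by real_asymp
      show "\<forall>\<^sub>F k in at_top. ereal ((r / 2 - 1) / (2 + k - r / 2)) \<le> c"
        using eventually_gt_at_top[of "r / 2"]
        by (rule eventually_mono, intro bound) (use r PInf in auto)
    qed simp
    moreover have "(a - 1) / (2 + b - a) = 0"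
      using r PInf by (simp add: one_ereal_def)
    ultimately show ?thesis by (simp add: zero_ereal_def)
  next
    case MInf
    with assms show ?thesis by simp
  qed
qed

text \<open>Reciprocals of infinite values are 0. If \<open>a\<close>, and hence \<open>b\<close>,
  is infinite, the quotient is \<open>1 / 0\<close>, which is infinite in \<open>ereal\<close>, so
  unbounded bounds are required.\<close>

lemma quotient_le_of_open_bounds_defect:
  fixes a b c :: ereal
  assumes "0 < a" "a \<le> b"
    and bound: "\<And>\<alpha> \<beta>. 0 < \<alpha> \<Longrightarrow> \<alpha> < \<beta> \<Longrightarrow> ereal \<alpha> < a \<Longrightarrow> ereal \<beta> < b \<Longrightarrow>
      ereal ((1 - 1 / \<alpha>) / (1 / \<beta> + 1 / \<alpha>)) \<le> c"
  shows "(1 - inverse a) / (inverse b + inverse a) \<le> c"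
proof (cases "a = \<infinity>")
  case True
  with assms(2) have b: "b = \<infinity>" by simp
  have "c = \<infinity>"
  proof (rule ereal_eq_top_of_filterlim)
    show "filterlim (\<lambda>k::real. (1 - 1 / k) / (1 / (2 * k) + 1 / k)) at_top at_top"
      by real_asymp
    show "\<forall>\<^sub>F k in at_top. ereal ((1 - 1 / k) / (1 / (2 * k) + 1 / k)) \<le> c"
      using eventually_gt_at_top[of 0]
      by (rule eventually_mono, intro bound) (use True b in auto)
  qed simp
  then show ?thesis by simp
next
  case False
  then obtain r where r: "a = ereal r" "0 < r"
    using assms(1) by (cases a) auto
  show ?thesis
  proof (cases b)
    case (real R)
    have R: "r \<le> R" "0 < R" using assms(2) r real by simp_all
    have pos: "0 < 1 / R + 1 / r" using r R by (simp add: add_pos_pos)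
    have "ereal ((1 - 1 / r) / (1 / R + 1 / r)) \<le> c"
    proof (rule ereal_le_of_tendsto)
      show "((\<lambda>e. (1 - 1 / (r - 2 * e)) / (1 / (R - e) + 1 / (r - 2 * e))) \<longlongrightarrow>
          (1 - 1 / r) / (1 / R + 1 / r)) (at_right 0)"
        using r R pos by (auto intro!: tendsto_eq_intros)
      show "\<forall>\<^sub>F e in at_right 0. ereal ((1 - 1 / (r - 2 * e)) / (1 / (R - e) + 1 / (r - 2 * e))) \<le> c"
        using eventually_at_right_0_less[OF half_gt_zero[OF r(2)]]
        by (rule eventually_mono, intro bound) (use r real R in auto)
    qed simp
    moreover have "(1 - inverse a) / (inverse b + inverse a) = ereal ((1 - 1 / r) / (1 / R + 1 / r))"
      using r real R pos by (simp add: one_ereal_def inverse_eq_divide)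
    ultimately show ?thesis by simp
  next
    case PInf
    have "ereal ((1 - 1 / r) / (0 + 1 / r)) \<le> c"
    proof (rule ereal_le_of_tendsto)
      have "((\<lambda>k::real. 1 / k) \<longlongrightarrow> 0) at_top" "((\<lambda>k. r - 1 / k) \<longlongrightarrow> r) at_top"
        by real_asymp+
      \<comment> \<open>Here \<alpha> is \<open>r - 1 / k\<close>, increasing to \<open>r\<close>,
        while \<beta> is \<open>k\<close> and tends to infinity.\<close>
      then show "((\<lambda>k. (1 - 1 / (r - 1 / k)) / (1 / k + 1 / (r - 1 / k))) \<longlongrightarrow>
          (1 - 1 / r) / (0 + 1 / r)) at_top"
        using r by (intro tendsto_intros) auto
      show "\<forall>\<^sub>F k in at_top. ereal ((1 - 1 / (r - 1 / k)) / (1 / k + 1 / (r - 1 / k))) \<le> c"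
        using eventually_gt_at_top[of "max r (1 / r)"]
      proof (rule eventually_mono)
        fix k assume k: "max r (1 / r) < k"
        then have "0 < k" using r by simp
        then have "1 / k < r" "0 < 1 / k" using k r by (simp_all add: field_simps)
        moreover have "r - 1 / k < r" using \<open>0 < k\<close> by simp
        then have "r - 1 / k < k" by (rule less_trans) (use k in simp)
        ultimately show "ereal ((1 - 1 / (r - 1 / k)) / (1 / k + 1 / (r - 1 / k))) \<le> c"
          using r PInf by (intro bound) auto
      qed
    qed simp
    moreover have "(1 - inverse a) / (inverse b + inverse a) = ereal ((1 - 1 / r) / (0 + 1 / r))"
      using r PInf by (simp add: one_ereal_def inverse_eq_divide)
    ultimately show ?thesis by simp
  next
    case MInf
    with assms show ?thesis by simp
  qed
qed

section \<open>Bounds for the second exponent\<close>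

context linear_system
begin

text \<open>With \<open>s = 1\<close>, the sizes that must decay are given exponents one below those
  of the system, for an arbitrarily large \<gamma>.\<close>

lemma regular_exponent_2_eq_top:
  assumes "\<And>a1 a2. small_bivectors 0 a1 a2"
  shows "regular_exponent \<Theta> 2 = \<infinity>"
proof (rule ereal_top)
  fix B :: real
  define \<gamma> where "\<gamma> = max B 0"
  have "ereal \<gamma> \<le> regular_exponent \<Theta> 2"
  proof (cases "m = 1")
    case True
    show ?thesis
      by (rule small_bivectors_imp_regular_exponent_ge_single[OF assms[of 0 "- \<gamma> - 1"] True, of 1]) auto
  next
    case False
    with m_pos show ?thesis
      by (intro small_bivectors_imp_regular_exponent_ge_multi[OF assms[of "- \<gamma> - 1" "- 2 * \<gamma> - 2"], of 1])
        (auto simp: \<gamma>_def)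
  qed
  then show "ereal B \<le> regular_exponent \<Theta> 2"
    by (rule order_trans[rotated]) (simp add: \<gamma>_def)
qed

text \<open>Slightly larger \<open>\<alpha>'\<close> and \<open>\<beta>'\<close> provide the strict
  inequalities that absorb constants. Where a quotient is claimed, it and the scale \<open>s\<close>
  solve two of the exponent comparisons as equalities at \<alpha> and \<beta>.\<close>

lemma regular_exponent_2_bounds:
  fixes \<alpha> \<beta> :: real
  assumes trivial: "\<And>z :: nat \<Rightarrow> int. defect z = 0 \<Longrightarrow> \<not> nontrivial z"
    and \<alpha>: "0 < \<alpha>" "\<alpha> < \<beta>" "ereal \<alpha> < uniform_exponent \<Theta> 1"
    and \<beta>: "ereal \<beta> < regular_exponent \<Theta> 1"
  shows "m = 1 \<Longrightarrow> \<alpha> < 1 \<Longrightarrow> ereal ((\<alpha> + \<beta>) / (1 - \<alpha>)) \<le> regular_exponent \<Theta> 2"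
    and "m = 1 \<Longrightarrow> 1 \<le> \<alpha> \<Longrightarrow> regular_exponent \<Theta> 2 = \<infinity>"
    and "m \<ge> 2 \<Longrightarrow> ereal ((\<alpha> - 1) / (2 + \<beta> - \<alpha>)) \<le> regular_exponent \<Theta> 2"
    and "m \<ge> 2 \<Longrightarrow> ereal ((1 - 1 / \<alpha>) / (1 / \<beta> + 1 / \<alpha>)) \<le> regular_exponent \<Theta> 2"
proof -
  obtain \<alpha>' where \<alpha>': "\<alpha> < \<alpha>'" "\<alpha>' < \<beta>" "ereal \<alpha>' < uniform_exponent \<Theta> 1"
    using ereal_dense2[of "ereal \<alpha>" "min (ereal \<beta>) (uniform_exponent \<Theta> 1)"] \<alpha> by auto
  obtain \<beta>' where \<beta>': "\<beta> < \<beta>'" "ereal \<beta>' < regular_exponent \<Theta> 1"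
    using ereal_dense2[OF \<beta>] by auto
  have height: "small_bivectors 2 (1 - \<alpha>') (- \<alpha>' - \<beta>')"
    and defect: "small_bivectors (1 / \<alpha>' + 1 / \<beta>') (1 / \<alpha>' - 1) (- 2)"
    using trivial \<alpha> \<alpha>' \<beta>' by (auto intro!: small_bivectors_by_height small_bivectors_by_defect)
  have distrib: "s * (1 + 2 * g) = s + 2 * (s * g)" for s g :: real by (simp add: algebra_simps)
  show "ereal ((\<alpha> + \<beta>) / (1 - \<alpha>)) \<le> regular_exponent \<Theta> 2" if "m = 1" "\<alpha> < 1"
    by (rule small_bivectors_imp_regular_exponent_ge_single[OF height that(1), of "1 - \<alpha>"])
      (use that \<alpha>' \<beta>' in auto)
  show "regular_exponent \<Theta> 2 = \<infinity>" if "m = 1" "1 \<le> \<alpha>"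
  proof (rule ereal_top)
    fix B :: real
    \<comment> \<open>Here \<open>1 - \<alpha>'\<close> is negative, so every positive
      \<open>s\<close> meets the first comparison; this one also gives
      \<open>s * B \<le> 1 < \<alpha>' + \<beta>'\<close>.\<close>
    define s where "s = 1 / (max B 1)"
    have s: "0 < s" "s * B \<le> 1" by (auto simp: s_def field_simps max_def)
    show "ereal B \<le> regular_exponent \<Theta> 2"
      by (rule small_bivectors_imp_regular_exponent_ge_single[OF height that(1) s(1)])
        (use s that \<alpha> \<alpha>' \<beta>' in linarith)+
  qed
  show "ereal ((\<alpha> - 1) / (2 + \<beta> - \<alpha>)) \<le> regular_exponent \<Theta> 2" if "m \<ge> 2"
  proof (rule small_bivectors_imp_regular_exponent_ge_multi[OF height that, of "2 + \<beta> - \<alpha>"])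
    let ?s = "2 + \<beta> - \<alpha>" and ?g = "(\<alpha> - 1) / (2 + \<beta> - \<alpha>)"
    show s: "0 < ?s" "2 < ?s" using \<alpha> by auto
    then have sg: "?s * ?g = \<alpha> - 1" by simp
    with \<alpha>' show "?s * ?g < - (1 - \<alpha>')" by simp
    have "?s * (1 + 2 * ?g) = ?s + 2 * (?s * ?g)" by (rule distrib)
    also have "\<dots> = \<alpha> + \<beta>" unfolding sg by simp
    finally show "?s * (1 + 2 * ?g) < - (- \<alpha>' - \<beta>')" using \<alpha>' \<beta>' by simp
    show "- 1 \<le> ?g" using s \<alpha> by (simp add: field_simps)
  qed
  show "ereal ((1 - 1 / \<alpha>) / (1 / \<beta> + 1 / \<alpha>)) \<le> regular_exponent \<Theta> 2" if "m \<ge> 2"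
  proof (rule small_bivectors_imp_regular_exponent_ge_multi[OF defect that, of "1 / \<beta> + 1 / \<alpha>"])
    let ?s = "1 / \<beta> + 1 / \<alpha>" and ?g = "(1 - 1 / \<alpha>) / (1 / \<beta> + 1 / \<alpha>)"
    have inv: "1 / \<alpha>' < 1 / \<alpha>" "1 / \<beta>' < 1 / \<beta>" "1 / \<beta> < 1 / \<alpha>" "0 < 1 / \<beta>"
      using \<alpha> \<alpha>' \<beta>' by (auto intro!: divide_strict_left_mono)
    show s: "0 < ?s" "1 / \<alpha>' + 1 / \<beta>' < ?s" using inv by linarith+
    have sg: "?s * ?g = 1 - 1 / \<alpha>" using s(1) by simp
    with inv show "?s * ?g < - (1 / \<alpha>' - 1)" by linarith
    have "?s * (1 + 2 * ?g) = ?s + 2 * (?s * ?g)" by (rule distrib)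
    also have "\<dots> = 2 + (1 / \<beta> - 1 / \<alpha>)" unfolding sg by simp
    also have "\<dots> < 2" using inv by simp
    finally show "?s * (1 + 2 * ?g) < - (- 2)" by simp
    \<comment> \<open>After multiplication by \<open>?s\<close> and cancellation of
      \<open>1 / \<alpha>\<close>, the claim \<open>- 1 \<le> ?g\<close> reduces to this.\<close>
    have "- 1 \<le> 1 / \<beta>" by (rule order_trans[OF _ less_imp_le[OF inv(4)]]) simp
    then have "?s * (- 1) \<le> ?s * ?g" unfolding sg by (simp add: algebra_simps)
    then show "- 1 \<le> ?g" using s(1) by (simp only: mult_le_cancel_left_pos)
  qed
qed

end

theorem theorem2:
  fixes m n :: nat and \<Theta> :: "real mat"
  assumes "n \<ge> 1" and "m \<ge> 1" and "n + m \<ge> 3"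
    and "\<Theta> \<in> carrier_mat n m"
    and "\<not> rank_one_lattice (m + n) (integer_solutions \<Theta>)"
  shows "(m = 1 \<longrightarrow>
            regular_exponent \<Theta> 2 \<ge>
              (regular_exponent \<Theta> 1 + uniform_exponent \<Theta> 1) / (1 - uniform_exponent \<Theta> 1))
       \<and> (m \<ge> 2 \<longrightarrow>
            (uniform_exponent \<Theta> 1 \<noteq> \<infinity> \<longrightarrow>
              regular_exponent \<Theta> 2 \<ge>
                (uniform_exponent \<Theta> 1 - 1) /
                  (2 + regular_exponent \<Theta> 1 - uniform_exponent \<Theta> 1))
          \<and> regular_exponent \<Theta> 2 \<ge>
              (1 - inverse (uniform_exponent \<Theta> 1)) /
                (inverse (regular_exponent \<Theta> 1) + inverse (uniform_exponent \<Theta> 1)))"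
proof -
  interpret linear_system m n \<Theta>
    using assms by unfold_locales
  note pos = uniform_exponent_pos and le = uniform_le_regular_exponent[of 1]
  show ?thesis
  proof (cases "\<exists>z :: nat \<Rightarrow> int. defect z = 0 \<and> nontrivial z")
    case True
    then obtain u p :: "nat \<Rightarrow> int" where "defect u = 0" "defect p = 0" "bivector u p \<noteq> (\<lambda>_. 0)"
      using rank_one_or_independent_solutions[OF assms(5)] by metis
    then have "regular_exponent \<Theta> 2 = \<infinity>"
      by (intro regular_exponent_2_eq_top small_bivectors_of_two_solutions)
    then show ?thesis by simp
  next
    case False
    then have trivial: "\<And>z :: nat \<Rightarrow> int. defect z = 0 \<Longrightarrow> \<not> nontrivial z" by blast
    show ?thesis
    proof (intro conjI impI)
      assume "m = 1"
      show "(regular_exponent \<Theta> 1 + uniform_exponent \<Theta> 1) / (1 - uniform_exponent \<Theta> 1) \<le> regular_exponent \<Theta> 2"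
      proof (rule quotient_le_of_open_bounds_single[OF pos le])
        \<comment> \<open>A uniform exponent above 1 is covered rather than ruled out: the case
          \<alpha> = 1 of the bounds already makes the second exponent infinite.\<close>
        assume "1 < uniform_exponent \<Theta> 1"
        then obtain \<beta> where \<beta>: "1 < \<beta>" "ereal \<beta> < uniform_exponent \<Theta> 1"
          using ereal_dense2[of 1 "uniform_exponent \<Theta> 1"] by (auto simp: one_ereal_def)
        have "ereal 1 < uniform_exponent \<Theta> 1" "ereal \<beta> < regular_exponent \<Theta> 1"
          using \<beta> le \<open>1 < uniform_exponent \<Theta> 1\<close> by (auto simp: one_ereal_def)
        with \<beta> show "regular_exponent \<Theta> 2 = \<infinity>"
          using regular_exponent_2_bounds(2)[OF trivial, of 1 \<beta>] \<open>m = 1\<close> by simp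
      qed (rule regular_exponent_2_bounds(1)[OF trivial], simp_all add: \<open>m = 1\<close>)
    next
      assume "m \<ge> 2" "uniform_exponent \<Theta> 1 \<noteq> \<infinity>"
      then show "(uniform_exponent \<Theta> 1 - 1) / (2 + regular_exponent \<Theta> 1 - uniform_exponent \<Theta> 1)
          \<le> regular_exponent \<Theta> 2"
        by (intro quotient_le_of_open_bounds_height pos le regular_exponent_2_bounds(3) trivial)
    next
      assume "m \<ge> 2"
      then show "(1 - inverse (uniform_exponent \<Theta> 1)) /
          (inverse (regular_exponent \<Theta> 1) + inverse (uniform_exponent \<Theta> 1)) \<le> regular_exponent \<Theta> 2"
        by (intro quotient_le_of_open_bounds_defect pos le regular_exponent_2_bounds(4) trivial)
    qed
  qed
qed

end
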